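(* For any $\gamma$-saturated normal uniform ideal $J$ on a cardinal $\kappa$ with $\gamma<\kappa$, any $m,n\in\omega$, and any measure algebra $\mathbb M$ (viewed as the forcing poset of its nonzero elements), $\mathbb M$ is $J^n$-$m$-linked.
   Context: All ideals are proper ($\kappa\notin J$) and uniform ($[\kappa]^{<\kappa}\subseteq J$); $J^*$ is the dual filter, $J^+$ the positive sets; normality is in the usual sense. $J$ is $\gamma$-saturated if for every $\langle X_i:i<\gamma\rangle\subseteq J^+$ there are $i<j<\gamma$ with $X_i\cap X_j\in J^+$. For $n\ge1$, $[\kappa]^n$ is the set of strictly increasing $n$-tuples from $\kappa$, identified with $n$-element subsets. Fubini powers: $J^0=\{\emptyset\}$ on $[\kappa]^0=\{\emptyset\}$, $J^1=J$, and for $n\ge2$, $X\subseteq[\kappa]^n$ is in $J^n$ iff $\{\alpha:\{\bar\beta\in[\kappa]^{n-1}:(\alpha,\bar\beta)\in X\}\in J^{n-1}\}\in J^*$; $(J^n)^+$ denotes the $J^n$-positive sets. For $a,b\in[\kappa]^n$, $a\simeq b$ means the order-preserving bijection from $a$ onto $b$ is the identity on $a\cap b$. A poset $P$ is $J^n$-$m$-linked if for every $X\in(J^n)^+$ and every $\langle p_a\in P:a\in X\rangle$ there is $Y\subseteq X$ with $Y\in(J^n)^+$ such that whenever $k\le m$ and $a_0,\dots,a_{k-1}\in Y$ are pairwise $\simeq$, the conditions $p_{a_0},\dots,p_{a_{k-1}}$ have a common lower bound in $P$. *)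

theory Defs
  imports Complex_Main "HOL-Library.Lub_Glb"
begin

unbundle cardinal_syntax

text \<open>
  The cardinal \<open>\<kappa>\<close> is the universe of a well-ordered type \<open>'k\<close> whose order type is an initial
  ordinal. An ordinal \<open>\<gamma> < \<kappa>\<close> is then an element \<open>\<gamma> :: 'k\<close>, identified with \<open>{..<\<gamma>}\<close>.
\<close>

definition is_cardinal_type :: "'k::wellorder itself \<Rightarrow> bool" where
  "is_cardinal_type _ \<longleftrightarrow> card_order {(x, y :: 'k). x \<le> y}"

definition proper_ideal :: "'k set set \<Rightarrow> bool" where
  "proper_ideal J \<longleftrightarrow>
     {} \<in> J \<and> (\<forall>A B. A \<in> J \<longrightarrow> B \<subseteq> A \<longrightarrow> B \<in> J) \<and> (\<forall>A B. A \<in> J \<longrightarrow> B \<in> J \<longrightarrow> A \<union> B \<in> J) \<and>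
     UNIV \<notin> J"

definition uniform_ideal :: "'k set set \<Rightarrow> bool" where
  "uniform_ideal J \<longleftrightarrow> (\<forall>A :: 'k set. |A| <o |UNIV :: 'k set| \<longrightarrow> A \<in> J)"

text \<open>Normality: closure under diagonal unions of length \<open>\<kappa>\<close>.\<close>

definition normal_ideal :: "'k::wellorder set set \<Rightarrow> bool" where
  "normal_ideal J \<longleftrightarrow> (\<forall>X. (\<forall>\<alpha>. X \<alpha> \<in> J) \<longrightarrow> {\<beta>. \<exists>\<alpha><\<beta>. \<beta> \<in> X \<alpha>} \<in> J)"

definition dual_filter :: "'k set set \<Rightarrow> 'k set set" where
  "dual_filter J = {A. - A \<in> J}"

definition saturated_ideal :: "'k::wellorder \<Rightarrow> 'k set set \<Rightarrow> bool" where
  "saturated_ideal \<gamma> J \<longleftrightarrow>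
     (\<forall>X. (\<forall>i<\<gamma>. X i \<notin> J) \<longrightarrow> (\<exists>i j. i < j \<and> j < \<gamma> \<and> X i \<inter> X j \<notin> J))"

definition increasing_tuples :: "nat \<Rightarrow> 'k::wellorder list set" where
  "increasing_tuples n = {a. length a = n \<and> sorted_wrt (<) a}"

fun fubini_power :: "'k::wellorder set set \<Rightarrow> nat \<Rightarrow> 'k list set set" where
  "fubini_power J 0 = {{}}"
| "fubini_power J (Suc 0) = {X. X \<subseteq> increasing_tuples 1 \<and> {\<alpha>. [\<alpha>] \<in> X} \<in> J}"
| "fubini_power J (Suc (Suc n)) =
     {X. X \<subseteq> increasing_tuples (Suc (Suc n)) \<and>
         {\<alpha>. {b \<in> increasing_tuples (Suc n). \<alpha> # b \<in> X} \<in> fubini_power J (Suc n)}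
           \<in> dual_filter J}"

definition fubini_positive :: "'k::wellorder set set \<Rightarrow> nat \<Rightarrow> 'k list set set" where
  "fubini_positive J n = {X. X \<subseteq> increasing_tuples n \<and> X \<notin> fubini_power J n}"

text \<open>The relation \<open>a \<simeq> b\<close>; increasing tuples are identified with their sets of entries.\<close>

definition compatible_tuples :: "'k::wellorder list \<Rightarrow> 'k list \<Rightarrow> bool" where
  "compatible_tuples a b \<longleftrightarrow>
     (\<exists>f. bij_betw f (set a) (set b) \<and> strict_mono_on (set a) f \<and>
          (\<forall>x \<in> set a \<inter> set b. f x = x))"

text \<open>The poset is a set \<open>P\<close> with the order of the ambient type \<open>'p\<close>.\<close>

definition fubini_linked ::
    "'k::wellorder set set \<Rightarrow> nat \<Rightarrow> nat \<Rightarrow> 'p::order set \<Rightarrow> bool" where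
  "fubini_linked J n m P \<longleftrightarrow>
     (\<forall>X \<in> fubini_positive J n. \<forall>p. (\<forall>a\<in>X. p a \<in> P) \<longrightarrow>
        (\<exists>Y \<in> fubini_positive J n. Y \<subseteq> X \<and>
           (\<forall>as. length as \<le> m \<longrightarrow> set as \<subseteq> Y \<longrightarrow>
                 (\<forall>a\<in>set as. \<forall>b\<in>set as. compatible_tuples a b) \<longrightarrow>
                 (\<exists>q\<in>P. \<forall>a\<in>set as. q \<le> p a))))"

text \<open>
  A measure algebra is a Dedekind sigma-complete Boolean algebra with a strictly positive,
  countably additive, finite measure; no normalization \<open>\<mu> top = 1\<close> is imposed. The class
  \<open>complete_boolean_algebra\<close> is not suitable here: it postulates complete distributivity and
  hence only covers atomic algebras.
\<close>

definition measure_algebra :: "('b::boolean_algebra \<Rightarrow> real) \<Rightarrow> bool" where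
  "measure_algebra \<mu> \<longleftrightarrow>
     (\<forall>f :: nat \<Rightarrow> 'b. \<exists>s. isLub UNIV (range f) s) \<and>
     \<mu> bot = 0 \<and> (\<forall>x. x \<noteq> bot \<longrightarrow> \<mu> x > 0) \<and>
     (\<forall>f s. (\<forall>i j. i \<noteq> j \<longrightarrow> inf (f i) (f j) = bot) \<longrightarrow> isLub UNIV (range f) s \<longrightarrow>
            (\<lambda>i::nat. \<mu> (f i)) sums \<mu> s)"

end

theory Submission
  imports Defs "HOL-Library.Countable"
begin

text \<open>
  Every element of a probability algebra is approximated by an event about finitely many
  independent uniform variables: well-order the algebra, and for each \<open>b\<close> choose finitely many
  earlier elements given which \<open>b\<close> is almost independent of all earlier ones. Choosing such sets
  recursively gives each \<open>p\<^sub>a\<close> a finite support, and up to a small error \<open>p\<^sub>a\<close> is computed from one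
  uniform variable for each element of the support, by a rule that takes only countably many values
  and hence may be assumed not to depend on \<open>a\<close>.

  On a smaller positive set of tuples, the \<open>i\<close>-th element of the support of \<open>p\<^sub>a\<close> determines and is
  determined by the coordinates of \<open>a\<close> in a fixed set \<open>I\<^sub>i\<close>. So pairwise compatible
  \<open>a\<^sub>0, \<dots>, a\<^sub>k\<^sub>-\<^sub>1\<close> give copies of one event, with variables indexed by restrictions of the tuples.
  Jensen's inequality, applied coordinate by coordinate to a grid containing the tuples, bounds the
  measure of the meet from below.
\<close>

section \<open>Normal ideals and Fubini powers\<close>

text \<open>Finitely many earlier elements cannot in general make \<open>b\<close> exactly
  independent of the other ones, so errors are unavoidable. They are measured by energy, the squared
  L2 norm of the conditional probability of \<open>b\<close>, which comes within any prescribed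
  amount of its supremum on a finite set. Each element added in this way needs a support of its own;
  well-foundedness keeps the total finite.

  The constants are chosen in the order \<epsilon>, \<open>c0\<close>, \<open>d\<close>,
  \<open>Q\<close>. The lower bound \<open>c0\<close> from Jensen's inequality depends on \<epsilon>
  and a bound for the number of grid points, and neither on the length of the supports nor on the
  sets \<open>I i\<close>, which arise only after \<open>d\<close> is fixed. So the error can be
  made small compared with it in advance.

  The grid is there because Jensen's inequality in one coordinate needs all combinations with the
  other coordinates. Its additional tuples need not be increasing or belong to the positive set:
  only the common rule is evaluated at them.\<close>

locale normal_uniform_ideal =
  fixes J :: "'k::wellorder set set"
  assumes empty: "{} \<in> J"
    and sub: "\<And>A B. A \<in> J \<Longrightarrow> B \<subseteq> A \<Longrightarrow> B \<in> J"
    and un: "\<And>A B. A \<in> J \<Longrightarrow> B \<in> J \<Longrightarrow> A \<union> B \<in> J"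
    and proper: "UNIV \<notin> J"
    and initial: "\<And>\<alpha>. {..\<alpha>} \<in> J"
    and normal: "normal_ideal J"
begin

text \<open>Fodor's lemma: otherwise all fibres of \<open>f\<close> would be in \<open>J\<close>,
  and \<open>S\<close> is contained in their diagonal union.\<close>

lemma regressive_constant:
  assumes "S \<notin> J" "\<And>\<alpha>. \<alpha> \<in> S \<Longrightarrow> f \<alpha> < \<alpha>"
  shows "\<exists>\<beta>. {\<alpha>\<in>S. f \<alpha> = \<beta>} \<notin> J"
proof (rule ccontr)
  assume "\<nexists>\<beta>. {\<alpha>\<in>S. f \<alpha> = \<beta>} \<notin> J"
  then have "{\<alpha>. \<exists>\<beta><\<alpha>. \<alpha> \<in> {\<alpha>\<in>S. f \<alpha> = \<beta>}} \<in> J"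
    using normal unfolding normal_ideal_def by (auto dest: spec[of _ "\<lambda>\<beta>. {\<alpha>\<in>S. f \<alpha> = \<beta>}"])
  moreover have "S \<subseteq> {\<alpha>. \<exists>\<beta><\<alpha>. \<alpha> \<in> {\<alpha>\<in>S. f \<alpha> = \<beta>}}" using assms(2) by auto
  ultimately show False using assms(1) sub by blast
qed

lemma positive_minus: "S \<notin> J \<Longrightarrow> A \<in> J \<Longrightarrow> S - A \<notin> J"
  using un[of "S - A" A] sub[of "S - A \<union> A" S] by blast

text \<open>If the iterated successors of the least element were unbounded, they would exhaust the
  order. The predecessor map would then be regressive above the least element with bounded fibres,
  against Fodor's lemma. A copy of \<omega> below a single point makes every countable-valued
  function regressive beyond that point.\<close>

lemma bounded_nat_embedding: "\<exists>(g :: nat \<Rightarrow> 'k) \<beta>. inj g \<and> (\<forall>i. g i < \<beta>)"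
proof -
  have no_max: "\<exists>y. y > x" for x :: 'k
  proof (rule ccontr)
    assume "\<not> ?thesis"
    then have "{..x} = UNIV" by (auto simp: not_less)
    then show False using initial proper by metis
  qed
  define s :: "'k \<Rightarrow> 'k" where "s x = (LEAST y. y > x)" for x
  have s: "x < s x" "y > x \<Longrightarrow> s x \<le> y" for x y
    unfolding s_def using no_max LeastI_ex[of "\<lambda>y. y > x"] Least_le[of "\<lambda>y. y > x" y] by auto
  define g :: "nat \<Rightarrow> 'k" where "g i = (s ^^ i) (LEAST x. True)" for i
  have gs: "g (Suc i) = s (g i)" for i by (simp add: g_def)
  have mono: "strict_mono g" unfolding strict_mono_Suc_iff using gs s by simp
  show ?thesis
  proof (cases "\<exists>\<beta>. \<forall>i. g i < \<beta>")
    case True then show ?thesis using mono strict_mono_imp_inj_on by blast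
  next
    case False
    have ex: "\<exists>i. \<beta> = g i" for \<beta>
    proof -
      obtain i where "\<beta> \<le> g i" using False not_le by blast
      then show ?thesis
      proof (induction i)
        case 0
        then show ?case unfolding g_def by (metis Least_le antisym funpow_0 id_apply)
      next
        case (Suc i)
        then show ?case using s gs by (metis not_le antisym)
      qed
    qed
    \<comment> \<open>The predecessor map. Truncated subtraction makes it fix \<open>g 0\<close>,
      hence the removal of \<open>{..g 0}\<close> below.\<close>
    define f where "f \<beta> = g ((THE i. \<beta> = g i) - 1)" for \<beta>
    have inj: "inj g" using mono strict_mono_imp_inj_on by blast
    have fg: "f (g i) = g (i - 1)" for i
    proof -
      have "(THE j. g i = g j) = i" using inj by (auto simp: inj_def)
      then show ?thesis by (simp add: f_def)
    qed
    have pos: "- {..g 0} \<notin> J" using positive_minus[OF proper initial] by (simp add: Compl_eq_Diff_UNIV)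
    have "f \<beta> < \<beta>" if "\<beta> \<in> - {..g 0}" for \<beta>
    proof -
      obtain i where i: "\<beta> = g i" using ex by blast
      then have "i \<noteq> 0" using that by (metis Compl_iff atMost_iff order_refl)
      then show ?thesis using i fg mono by (simp add: strict_mono_less)
    qed
    from regressive_constant[OF pos this]
    obtain \<beta> where b: "{\<alpha> \<in> - {..g 0}. f \<alpha> = \<beta>} \<notin> J" by blast
    obtain j where j: "\<beta> = g j" using ex by blast
    have "{\<alpha> \<in> - {..g 0}. f \<alpha> = \<beta>} \<subseteq> {..g (Suc j)}"
    proof
      fix \<alpha> assume a: "\<alpha> \<in> {\<alpha> \<in> - {..g 0}. f \<alpha> = \<beta>}"
      obtain i where i: "\<alpha> = g i" using ex by blast
      have "i - 1 = j" using a i fg j inj by (auto simp: inj_def)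
      then show "\<alpha> \<in> {..g (Suc j)}" using i mono by (auto simp: strict_mono_less_eq)
    qed
    then show ?thesis using b initial sub by blast
  qed
qed

lemma countable_constant:
  fixes f :: "'k \<Rightarrow> 'c::countable"
  assumes "S \<notin> J"
  shows "\<exists>c. {\<alpha>\<in>S. f \<alpha> = c} \<notin> J"
proof -
  obtain g :: "nat \<Rightarrow> 'k" and \<beta> where g: "inj g" "\<And>i. g i < \<beta>" using bounded_nat_embedding by blast
  have S: "S - {..\<beta>} \<notin> J" using assms initial positive_minus by blast
  obtain \<gamma> where \<gamma>: "{\<alpha> \<in> S - {..\<beta>}. g (to_nat (f \<alpha>)) = \<gamma>} \<notin> J"
    using regressive_constant[OF S, of "\<lambda>\<alpha>. g (to_nat (f \<alpha>))"] g(2) by (force intro: less_trans)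
  then obtain \<alpha>0 where "g (to_nat (f \<alpha>0)) = \<gamma>" using empty by (metis (mono_tags, lifting) Collect_empty_eq)
  then have "{\<alpha> \<in> S - {..\<beta>}. g (to_nat (f \<alpha>)) = \<gamma>} \<subseteq> {\<alpha>\<in>S. f \<alpha> = f \<alpha>0}"
    using g(1) by (auto dest!: injD)
  then show ?thesis using \<gamma> sub by blast
qed

text \<open>Fix the length, then apply Fodor's lemma to one entry at a time.\<close>

lemma regressive_list_constant:
  assumes "S \<notin> J" "\<And>\<alpha>. \<alpha> \<in> S \<Longrightarrow> \<forall>x\<in>set (f \<alpha>). x < \<alpha>"
  shows "\<exists>l. {\<alpha>\<in>S. f \<alpha> = l} \<notin> J"
proof -
  obtain r where r: "{\<alpha>\<in>S. length (f \<alpha>) = r} \<notin> J" using countable_constant[OF assms(1), of "\<lambda>\<alpha>. length (f \<alpha>)"] by blast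
  have "\<exists>l. {\<alpha>\<in>S. f \<alpha> = l} \<notin> J" if "S \<notin> J" "\<And>\<alpha>. \<alpha> \<in> S \<Longrightarrow> length (f \<alpha>) = r \<and> (\<forall>x\<in>set (f \<alpha>). x < \<alpha>)" for S f
    using that
  proof (induction r arbitrary: S f)
    case 0
    then have "{\<alpha>\<in>S. f \<alpha> = []} = S" by auto
    with 0 show ?case by metis
  next
    case (Suc r)
    have ne: "f \<alpha> \<noteq> []" if "\<alpha> \<in> S" for \<alpha> using Suc.prems(2)[OF that] by auto
    have "\<And>\<alpha>. \<alpha> \<in> S \<Longrightarrow> hd (f \<alpha>) < \<alpha>" using Suc.prems(2) ne by (simp add: hd_in_set)
    from regressive_constant[OF Suc.prems(1) this] obtain x where x: "{\<alpha>\<in>S. hd (f \<alpha>) = x} \<notin> J" by blast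
    have "length (tl (f \<alpha>)) = r \<and> (\<forall>x\<in>set (tl (f \<alpha>)). x < \<alpha>)" if "\<alpha> \<in> {\<alpha>\<in>S. hd (f \<alpha>) = x}" for \<alpha>
      using Suc.prems(2)[of \<alpha>] ne[of \<alpha>] that by (auto dest: list.set_sel(2))
    from Suc.IH[OF x this] obtain l where l: "{\<alpha> \<in> {\<alpha>\<in>S. hd (f \<alpha>) = x}. tl (f \<alpha>) = l} \<notin> J" by blast
    have "{\<alpha> \<in> {\<alpha>\<in>S. hd (f \<alpha>) = x}. tl (f \<alpha>) = l} \<subseteq> {\<alpha>\<in>S. f \<alpha> = x # l}"
      using ne by (auto simp: neq_Nil_conv)
    then show ?case using l sub by blast
  qed
  from this[OF r, of f] obtain l where "{\<alpha> \<in> {\<alpha>\<in>S. length (f \<alpha>) = r}. f \<alpha> = l} \<notin> J" using assms(2) by blast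
  moreover have "{\<alpha> \<in> {\<alpha>\<in>S. length (f \<alpha>) = r}. f \<alpha> = l} \<subseteq> {\<alpha>\<in>S. f \<alpha> = l}" by auto
  ultimately show ?thesis using sub by blast
qed

text \<open>Positivity for the Fubini power, written as a single recursion on sections that starts
  at \<open>0\<close> and leaves aside whether tuples increase. On sets of increasing tuples it is
  the stated notion, by \<open>fubini_power_iff\<close>.\<close>

fun pos :: "nat \<Rightarrow> 'k list set \<Rightarrow> bool" where
  "pos 0 X \<longleftrightarrow> [] \<in> X"
| "pos (Suc n) X \<longleftrightarrow> {\<alpha>. pos n {b. \<alpha> # b \<in> X}} \<notin> J"

lemma pos_mono: "pos n X \<Longrightarrow> X \<subseteq> Y \<Longrightarrow> pos n Y"
proof (induction n arbitrary: X Y)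
  case (Suc n)
  have "{\<alpha>. pos n {b. \<alpha> # b \<in> X}} \<subseteq> {\<alpha>. pos n {b. \<alpha> # b \<in> Y}}"
    
  proof
    fix \<alpha> assume "\<alpha> \<in> {\<alpha>. pos n {b. \<alpha> # b \<in> X}}"
    then show "\<alpha> \<in> {\<alpha>. pos n {b. \<alpha> # b \<in> Y}}" using Suc.IH[of _ "{b. \<alpha> # b \<in> Y}"] Suc.prems(2) by auto
  qed
  then show ?case using Suc.prems(1) sub unfolding pos.simps by blast
qed auto

lemma not_pos_empty: "\<not> pos n {}"
  by (induction n) (auto simp: empty)

lemma pos_nonempty: "pos n X \<Longrightarrow> \<exists>a. a \<in> X"
  using not_pos_empty by (metis ex_in_conv)

lemma pos_Un: "pos n (X \<union> Y) \<Longrightarrow> pos n X \<or> pos n Y"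
proof (induction n arbitrary: X Y)
  case (Suc n)
  have "{\<alpha>. pos n {b. \<alpha> # b \<in> X \<union> Y}} \<subseteq> {\<alpha>. pos n {b. \<alpha> # b \<in> X}} \<union> {\<alpha>. pos n {b. \<alpha> # b \<in> Y}}"
  proof
    fix \<alpha> assume "\<alpha> \<in> {\<alpha>. pos n {b. \<alpha> # b \<in> X \<union> Y}}"
    then have "pos n ({b. \<alpha> # b \<in> X} \<union> {b. \<alpha> # b \<in> Y})" by (simp add: Collect_disj_eq)
    then show "\<alpha> \<in> {\<alpha>. pos n {b. \<alpha> # b \<in> X}} \<union> {\<alpha>. pos n {b. \<alpha> # b \<in> Y}}" using Suc.IH by simp
  qed
  then show ?case using Suc.prems sub un unfolding pos.simps by blast
qed auto

lemma pos_finite_Union: "finite \<B> \<Longrightarrow> pos n (X \<union> \<Union>\<B>) \<Longrightarrow> (\<And>B. B \<in> \<B> \<Longrightarrow> \<not> pos n B) \<Longrightarrow> pos n X"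
proof (induction \<B> rule: finite_induct)
  case (insert B \<B>)
  have "pos n ((X \<union> \<Union>\<B>) \<union> B)" using insert.prems by (simp add: Un_ac)
  then show ?case using insert pos_Un by blast
qed auto

text \<open>The constant found on the section at \<alpha> is a countable-valued function of
  \<alpha>, so it can itself be made constant.\<close>

lemma pos_countable_constant:
  fixes f :: "'k list \<Rightarrow> 'c::countable"
  shows "pos n X \<Longrightarrow> \<exists>c. pos n {a\<in>X. f a = c}"
proof (induction n arbitrary: X f)
  case (Suc n)
  define S where "S = {\<alpha>. pos n {b. \<alpha> # b \<in> X}}"
  have "\<exists>c. pos n {b\<in>{b. \<alpha> # b \<in> X}. f (\<alpha> # b) = c}" if "\<alpha> \<in> S" for \<alpha>
    using Suc.IH[of _ "\<lambda>b. f (\<alpha> # b)"] that unfolding S_def by blast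
  then obtain c where c: "\<And>\<alpha>. \<alpha> \<in> S \<Longrightarrow> pos n {b\<in>{b. \<alpha> # b \<in> X}. f (\<alpha> # b) = c \<alpha>}" by metis
  obtain d where d: "{\<alpha>\<in>S. c \<alpha> = d} \<notin> J" 
    using countable_constant[of S c] Suc.prems unfolding S_def pos.simps by blast
  have "{\<alpha>\<in>S. c \<alpha> = d} \<subseteq> {\<alpha>. pos n {b. \<alpha> # b \<in> {a\<in>X. f a = d}}}"
  proof
    fix \<alpha> assume "\<alpha> \<in> {\<alpha>\<in>S. c \<alpha> = d}"
    then show "\<alpha> \<in> {\<alpha>. pos n {b. \<alpha> # b \<in> {a\<in>X. f a = d}}}" using c[of \<alpha>] by simp
  qed
  then show ?case using d sub unfolding pos.simps by blast
qed auto

text \<open>For \<alpha> above \<beta>, the constant list found on the section at \<alpha> has all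
  its entries below \<alpha>, so its choice is regressive and Fodor's lemma fixes it.\<close>

lemma pos_bounded_list_constant:
  "pos n X \<Longrightarrow> (\<And>a. a \<in> X \<Longrightarrow> \<forall>x\<in>set (g a). x < (\<beta>::'k)) \<Longrightarrow> \<exists>l. pos n {a\<in>X. g a = l}"
proof (induction n arbitrary: X g)
  case (Suc n)
  define S where "S = {\<alpha>. pos n {b. \<alpha> # b \<in> X}} - {..\<beta>}"
  have S: "S \<notin> J" using Suc.prems(1) positive_minus initial S_def by auto
  have "\<exists>l. pos n {b\<in>{b. \<alpha> # b \<in> X}. g (\<alpha> # b) = l}" if "\<alpha> \<in> S" for \<alpha>
    using Suc.IH[of "{b. \<alpha> # b \<in> X}" "\<lambda>b. g (\<alpha> # b)"] that Suc.prems(2) unfolding S_def by blast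
  then obtain l where l: "\<And>\<alpha>. \<alpha> \<in> S \<Longrightarrow> pos n {b\<in>{b. \<alpha> # b \<in> X}. g (\<alpha> # b) = l \<alpha>}" by metis
  have "\<forall>x\<in>set (l \<alpha>). x < \<alpha>" if "\<alpha> \<in> S" for \<alpha>
  proof -
    obtain b where "\<alpha> # b \<in> X" "g (\<alpha> # b) = l \<alpha>"
      using pos_nonempty[OF l[OF \<open>\<alpha> \<in> S\<close>]] by blast
    moreover have "\<beta> < \<alpha>" using that S_def by auto
    ultimately show ?thesis using Suc.prems(2) by (metis less_trans)
  qed
  from regressive_list_constant[OF S this] obtain d where d: "{\<alpha>\<in>S. l \<alpha> = d} \<notin> J" by blast
  have "{\<alpha>\<in>S. l \<alpha> = d} \<subseteq> {\<alpha>. pos n {b. \<alpha> # b \<in> {a\<in>X. g a = d}}}"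
  proof
    fix \<alpha> assume "\<alpha> \<in> {\<alpha>\<in>S. l \<alpha> = d}"
    then show "\<alpha> \<in> {\<alpha>. pos n {b. \<alpha> # b \<in> {a\<in>X. g a = d}}}" using l[of \<alpha>] by simp
  qed
  then show ?case using d sub unfolding pos.simps by blast
qed auto

text \<open>Fodor's lemma for tuples. The coordinates before \<open>l\<close> are kept as parameters
  by passing to sections. Once coordinate \<open>l\<close> is the first one, it bounds
  \<open>g\<close> on its section, so the later coordinates drop out by
  \<open>pos_bounded_list_constant\<close>, and the ordinary Fodor's lemma removes coordinate
  \<open>l\<close> itself.\<close>

lemma pos_regressive_list:
  "pos n X \<Longrightarrow> l < n \<Longrightarrow> (\<And>a. a \<in> X \<Longrightarrow> \<forall>x\<in>set (g a). x < a ! l) \<Longrightarrow>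
    \<exists>Y\<subseteq>X. pos n Y \<and> (\<exists>h. \<forall>a\<in>Y. g a = h (take l a))"
proof (induction n arbitrary: X g l)
  case (Suc n)
  define S where "S = {\<alpha>. pos n {b. \<alpha> # b \<in> X}}"
  have S: "S \<notin> J" using Suc.prems(1) S_def by auto
  show ?case
  proof (cases l)
    case 0
    have "\<exists>l. pos n {b\<in>{b. \<alpha> # b \<in> X}. g (\<alpha> # b) = l}" if "\<alpha> \<in> S" for \<alpha>
      
    proof (rule pos_bounded_list_constant[where \<beta> = \<alpha>])
      show "pos n {b. \<alpha> # b \<in> X}" using that S_def by simp
      show "\<forall>x\<in>set (g (\<alpha> # b)). x < \<alpha>" if "b \<in> {b. \<alpha> # b \<in> X}" for b
        using Suc.prems(3)[of "\<alpha> # b"] that 0 by simp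
    qed
    then obtain l' where l: "\<And>\<alpha>. \<alpha> \<in> S \<Longrightarrow> pos n {b\<in>{b. \<alpha> # b \<in> X}. g (\<alpha> # b) = l' \<alpha>}" by metis
    have "\<forall>x\<in>set (l' \<alpha>). x < \<alpha>" if "\<alpha> \<in> S" for \<alpha>
    proof -
      obtain b where "\<alpha> # b \<in> X" "g (\<alpha> # b) = l' \<alpha>"
        using pos_nonempty[OF l[OF \<open>\<alpha> \<in> S\<close>]] by blast
      then show ?thesis using Suc.prems(3)[of "\<alpha> # b"] 0 by simp
    qed
    from regressive_list_constant[OF S this] obtain d where d: "{\<alpha>\<in>S. l' \<alpha> = d} \<notin> J" by blast
    have "{\<alpha>\<in>S. l' \<alpha> = d} \<subseteq> {\<alpha>. pos n {b. \<alpha> # b \<in> {a\<in>X. g a = d}}}"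
  proof
    fix \<alpha> assume "\<alpha> \<in> {\<alpha>\<in>S. l' \<alpha> = d}"
    then show "\<alpha> \<in> {\<alpha>. pos n {b. \<alpha> # b \<in> {a\<in>X. g a = d}}}" using l[of \<alpha>] by simp
  qed
    then have "pos (Suc n) {a\<in>X. g a = d}" using d sub unfolding pos.simps by blast
    then show ?thesis by (intro exI[of _ "{a\<in>X. g a = d}"] conjI exI[of _ "\<lambda>_. d"]) auto
  next
    case (Suc l')
    have "\<exists>Y\<subseteq>{b. \<alpha> # b \<in> X}. pos n Y \<and> (\<exists>h. \<forall>b\<in>Y. g (\<alpha> # b) = h (take l' b))" if "\<alpha> \<in> S" for \<alpha>
      
    proof (rule Suc.IH)
      show "pos n {b. \<alpha> # b \<in> X}" using that S_def by simp
      show "l' < n" using Suc.prems(2) Suc by simp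
      show "\<forall>x\<in>set (g (\<alpha> # b)). x < b ! l'" if "b \<in> {b. \<alpha> # b \<in> X}" for b
        using Suc.prems(3)[of "\<alpha> # b"] that Suc by simp
    qed
    then obtain Y h where Y: "\<And>\<alpha>. \<alpha> \<in> S \<Longrightarrow> Y \<alpha> \<subseteq> {b. \<alpha> # b \<in> X} \<and> pos n (Y \<alpha>) \<and> (\<forall>b\<in>Y \<alpha>. g (\<alpha> # b) = h \<alpha> (take l' b))"
      by metis
    define Z where "Z = {\<alpha> # b | \<alpha> b. \<alpha> \<in> S \<and> b \<in> Y \<alpha>}"
    have sec: "{b. \<alpha> # b \<in> Z} = Y \<alpha>" if "\<alpha> \<in> S" for \<alpha> using that by (auto simp: Z_def)
    have "S \<subseteq> {\<alpha>. pos n {b. \<alpha> # b \<in> Z}}" using sec Y by auto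
    then have "pos (Suc n) Z" using S sub by auto
    moreover have "Z \<subseteq> X" using Y by (auto simp: Z_def)
    moreover have "\<forall>a\<in>Z. g a = (\<lambda>s. h (hd s) (tl s)) (take l a)" using Y Suc by (auto simp: Z_def)
    ultimately show ?thesis by (intro exI[of _ Z] conjI exI[of _ "\<lambda>s. h (hd s) (tl s)"]) auto
  qed
qed simp

end

section \<open>Restrictions of tuples to sets of coordinates\<close>

lemma nths_split:
  "nths a A = nths (take l a) A @ nths a (A \<inter> {l..})"
proof -
  have "nths a B = nths (take l a) B @ nths (drop l a) {j. j + length (take l a) \<in> B}" for B
    by (metis append_take_drop_id nths_append)
  moreover have "nths (take l a) (A \<inter> {l..}) = []"
    by (auto simp: nths_def filter_empty_conv set_zip)
  moreover have "nths (drop l a) {j. j + length (take l a) \<in> A \<inter> {l..}} = nths (drop l a) {j. j + length (take l a) \<in> A}"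
    by (cases "l \<le> length a") (auto simp: min_def)
  ultimately show ?thesis by (metis append_Nil)
qed

lemma nths_initial_Un:
  assumes "l < length a"
  shows "nths a ({..<l} \<union> (A \<inter> {l<..})) = take l a @ nths a (A \<inter> {l<..})"
proof -
  have "nths (take l a) ({..<l} \<union> (A \<inter> {l<..})) = take l a" by (rule nths_all) (use assms in auto)
  moreover have "({..<l} \<union> (A \<inter> {l<..})) \<inter> {l..} = A \<inter> {l<..}" by auto
  ultimately show ?thesis using nths_split[of a "{..<l} \<union> (A \<inter> {l<..})" l] by simp
qed

text \<open>With the weights \<open>2 ^ l\<close>, trading one coordinate for all smaller ones
  lowers the total weight.\<close>

lemma sum_power2_lessThan: "(\<Sum>l<(m::nat). (2::nat) ^ l) < 2 ^ m"
  by (induction m) auto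

lemma sorted_nths: "sorted_wrt P a \<Longrightarrow> sorted_wrt P (nths a A)"
proof (induction a arbitrary: A)
  case (Cons x a)
  then show ?case using set_nths_subset by (fastforce simp: nths_Cons)
qed simp

lemma sorted_wrt_set_unique:
  fixes xs ys :: "'k::linorder list"
  assumes "sorted_wrt (<) xs" "sorted_wrt (<) ys" "set xs = set ys"
  shows "xs = ys"
  using assms by (metis strict_sorted_equal)

text \<open>Replaces a condition on positions by one on values, which can be compared across
  different tuples.\<close>

lemma nths_above:
  fixes a :: "'k::linorder list"
  assumes "sorted_wrt (<) a" "l < length a"
  shows "nths a (A \<inter> {l<..}) = filter (\<lambda>x. x > a ! l) (nths a A)"
proof (rule sorted_wrt_set_unique)
  have *: "a ! p > a ! l \<longleftrightarrow> p > l" if "p < length a" for p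
    using assms that by (metis linorder_neqE_nat not_less_iff_gr_or_eq sorted_wrt_nth_less)
  show "set (nths a (A \<inter> {l<..})) = set (filter (\<lambda>x. x > a ! l) (nths a A))"
    using * by (auto simp: set_nths)
qed (use assms in \<open>auto intro: sorted_nths sorted_wrt_filter\<close>)

context normal_uniform_ideal
begin

text \<open>Minimising \<open>\<Sum>i<k. \<Sum>l\<in>I i. 2 ^ l\<close> makes the representation of \<open>e i\<close> through the coordinates
  in \<open>I i\<close> canonical: a coincidence of values on a positive set would, by Fodor's lemma, allow
  some coordinate in \<open>I i\<close> to be traded for smaller ones.\<close>

lemma canonical_form:
  fixes e :: "nat \<Rightarrow> 'k list \<Rightarrow> 's"
  assumes X: "pos n X" and inc: "X \<subseteq> increasing_tuples n"
  obtains Y I c where "Y \<subseteq> X" "pos n Y" "\<And>i a. i < k \<Longrightarrow> a \<in> Y \<Longrightarrow> e i a = c i (nths a (I i))"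
    "\<And>i j a b. i < k \<Longrightarrow> j < k \<Longrightarrow> a \<in> Y \<Longrightarrow> b \<in> Y \<Longrightarrow> e i a = e j b \<Longrightarrow> nths a (I i) = nths b (I j)"
proof -
  define R where "R Y I \<longleftrightarrow> Y \<subseteq> X \<and> pos n Y \<and> (\<forall>i<k. I i \<subseteq> {..<n}) \<and>
     (\<exists>c. \<forall>i<k. \<forall>a\<in>Y. e i a = c i (nths a (I i)))" for Y and I :: "nat \<Rightarrow> nat set"
  define w where "w I = (\<Sum>i<k. \<Sum>l\<in>I i. (2::nat) ^ l)" for I :: "nat \<Rightarrow> nat set"
  have len: "length a = n" "sorted_wrt (<) a" if "a \<in> X" for a
    using that inc by (auto simp: increasing_tuples_def)
  have "R X (\<lambda>_. {..<n})"
  proof -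
    have "\<forall>i<k. \<forall>a\<in>X. e i a = e i (nths a {..<n})" using len by (auto simp: nths_all)
    then show ?thesis using X by (auto simp: R_def)
  qed
  then obtain Y I where R: "R Y I" and min: "\<And>Y' I'. R Y' I' \<Longrightarrow> w I \<le> w I'"
    using ex_has_least_nat[of "\<lambda>(Y, I). R Y I" "(X, \<lambda>_. {..<n})" "\<lambda>(Y, I). w I"] by auto
  obtain c where Y: "Y \<subseteq> X" "pos n Y" and I: "\<And>i. i < k \<Longrightarrow> I i \<subseteq> {..<n}"
    and c: "\<And>i a. i < k \<Longrightarrow> a \<in> Y \<Longrightarrow> e i a = c i (nths a (I i))"
    using R unfolding R_def by blast
  \<comment> \<open>\<open>ts\<close> stands in for those entries of the restriction of some other
    tuple that are below \<open>a ! l\<close>. Quantifying over \<open>ts\<close> lets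
    \<open>Bad\<close> refer to \<open>a\<close> alone, so that Fodor's lemma for tuples
    applies.\<close>
  define Bad where "Bad = (\<lambda>(i, j, l). {a\<in>Y. \<exists>ts. (\<forall>x\<in>set ts. x < a ! l) \<and>
      c i (nths a (I i)) = c j (ts @ nths a (I i \<inter> {l<..}))})"
  define \<B> where "\<B> = Bad ` (SIGMA i:{..<k}. {..<k} \<times> I i)"
  have null: "\<not> pos n (Bad (i, j, l))" if ij: "i < k" "j < k" and l: "l \<in> I i" for i j l
  proof
    assume bad: "pos n (Bad (i, j, l))"
    have ln: "l < n" using I[OF ij(1)] l by auto
    have "\<exists>ts. (\<forall>x\<in>set ts. x < a ! l) \<and> c i (nths a (I i)) = c j (ts @ nths a (I i \<inter> {l<..}))"
      if "a \<in> Bad (i, j, l)" for a using that unfolding Bad_def by auto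
    then obtain ts where ts: "\<And>a. a \<in> Bad (i, j, l) \<Longrightarrow> (\<forall>x\<in>set (ts a). x < a ! l) \<and>
        c i (nths a (I i)) = c j (ts a @ nths a (I i \<inter> {l<..}))"
      by metis
    obtain Z h where Z: "Z \<subseteq> Bad (i, j, l)" "pos n Z" and h: "\<And>a. a \<in> Z \<Longrightarrow> ts a = h (take l a)"
      using pos_regressive_list[OF bad ln, of ts] ts by blast
    \<comment> \<open>Since \<open>ts a\<close> depends only on \<open>take l a\<close>, coordinate
      \<open>l\<close> can be replaced by all coordinates below it. The restriction to the new set
      starts with these, and \<open>c'\<close> rebuilds \<open>ts a\<close> from them.\<close>
    define I' where "I' = I(i := {..<l} \<union> (I i \<inter> {l<..}))"
    define c' where "c' = c(i := \<lambda>s. c j (h (take l s) @ drop l s))"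
    have ZY: "Z \<subseteq> Y" using Z by (auto simp: Bad_def)
    have "e i' a = c' i' (nths a (I' i'))" if "i' < k" "a \<in> Z" for i' a
    proof (cases "i' = i")
      case True
      have a: "length a = n" using len that ZY Y by blast
      have "nths a (I' i) = take l a @ nths a (I i \<inter> {l<..})"
        unfolding I'_def using nths_initial_Un[of l a "I i"] a ln by simp
      moreover have "e i a = c j (h (take l a) @ nths a (I i \<inter> {l<..}))"
        using c[OF ij(1), of a] ts[of a] h[OF that(2)] subsetD[OF ZY that(2)] subsetD[OF Z(1) that(2)] by simp
      ultimately show ?thesis using True a ln by (simp add: c'_def)
    next
      case False
      then show ?thesis using c that ZY by (auto simp: c'_def I'_def)
    qed
    moreover have "\<forall>i'<k. I' i' \<subseteq> {..<n}" using I ln by (auto simp: I'_def)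
    ultimately have "R Z I'" unfolding R_def using Z ZY Y by (intro conjI exI[of _ c']) auto
    then have "w I \<le> w I'" by (rule min)
    moreover have "w I' < w I"
    proof -
      have fin: "finite (I i)" using I[OF ij(1)] finite_subset by blast
      have "(\<Sum>l\<in>I' i. (2::nat) ^ l) = (\<Sum>l<l. 2 ^ l) + (\<Sum>l\<in>I i \<inter> {l<..}. 2 ^ l)"
        unfolding I'_def using fin by (subst fun_upd_same, subst sum.union_disjoint) auto
      also have "\<dots> < 2 ^ l + (\<Sum>l\<in>I i \<inter> {l<..}. 2 ^ l)" using sum_power2_lessThan by simp
      also have "\<dots> = (\<Sum>l\<in>insert l (I i \<inter> {l<..}). 2 ^ l)" using fin by (subst sum.insert) auto
      also have "\<dots> \<le> (\<Sum>l\<in>I i. 2 ^ l)" using fin l by (intro sum_mono2) auto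
      finally show ?thesis unfolding w_def using ij(1)
        by (intro sum_strict_mono_ex1) (auto simp: I'_def)
    qed
    ultimately show False by simp
  qed
  have fin: "finite \<B>" unfolding \<B>_def using finite_subset[OF I finite_lessThan]
    by (intro finite_imageI finite_SigmaI finite_cartesian_product) auto
  define Z where "Z = Y - \<Union>\<B>"
  have "pos n Z"
  proof (rule pos_finite_Union[OF fin])
    show "pos n (Z \<union> \<Union>\<B>)" using Y(2) pos_mono unfolding Z_def by (metis Diff_partition Un_Diff_cancel2 Un_upper1)
  qed (use null in \<open>auto simp: \<B>_def\<close>)
  \<comment> \<open>Here \<open>u\<close> is the largest entry in which the two restrictions differ.
    They agree above \<open>u\<close>, so the entries of \<open>nths b (I j)\<close> below
    \<open>u\<close> form a list \<open>ts\<close> witnessing that \<open>a\<close> is bad. This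
    works for arbitrary \<open>a\<close> and \<open>b\<close> in \<open>Z\<close>.\<close>
  moreover have main: False
    if ij: "i < k" "j < k" and ab: "a \<in> Z" "b \<in> Z" and eq: "e i a = e j b"
      and u: "u \<in> set (nths a (I i))" "u \<notin> set (nths b (I j))"
      and above_u: "\<And>v. v > u \<Longrightarrow> v \<in> set (nths a (I i)) \<longleftrightarrow> v \<in> set (nths b (I j))" for i j a b u
  proof -
    let ?s = "nths a (I i)" and ?t = "nths b (I j)"
    obtain l where l: "l \<in> I i" "l < length a" "u = a ! l" using u(1) by (auto simp: set_nths)
    have a: "sorted_wrt (<) a" and b: "sorted_wrt (<) b" using ab Y len by (auto simp: Z_def)
    have above: "nths a (I i \<inter> {l<..}) = filter (\<lambda>x. x > u) ?s" using nths_above[OF a l(2)] l(3) by simp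
    have "?t = filter (\<lambda>x. x < u) ?t @ filter (\<lambda>x. x > u) ?s"
    proof (rule sorted_wrt_set_unique)
      show "set ?t = set (filter (\<lambda>x. x < u) ?t @ filter (\<lambda>x. x > u) ?s)" 
      proof -
        have "v < u \<or> v > u" if "v \<in> set ?t" for v using u(2) that by (metis linorder_neqE)
        then show ?thesis using above_u by auto
      qed
      show "sorted_wrt (<) (filter (\<lambda>x. x < u) ?t @ filter (\<lambda>x. x > u) ?s)"
        using sorted_nths[OF a] sorted_nths[OF b] by (auto simp: sorted_wrt_append intro: sorted_wrt_filter)
    qed (rule sorted_nths[OF b])
    then have "c i ?s = c j (filter (\<lambda>x. x < u) ?t @ nths a (I i \<inter> {l<..}))"
      using eq c ij ab above by (simp add: Z_def)
    then have "a \<in> Bad (i, j, l)" using ab l by (auto simp: Bad_def Z_def intro!: exI[of _ "filter (\<lambda>x. x < u) ?t"])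
    moreover have "Bad (i, j, l) \<in> \<B>" using ij l by (auto simp: \<B>_def)
    ultimately show False using ab(1) unfolding Z_def by blast
  qed
  moreover have "nths a (I i) = nths b (I j)"
    if ij: "i < k" "j < k" and ab: "a \<in> Z" "b \<in> Z" and eq: "e i a = e j b" for i j a b
  proof (rule sorted_wrt_set_unique)
    let ?s = "set (nths a (I i))" and ?t = "set (nths b (I j))"
    show "?s = ?t"
    proof (rule ccontr)
      assume "?s \<noteq> ?t"
      then have ne: "(?s - ?t) \<union> (?t - ?s) \<noteq> {}" by blast
      define u where "u = Max ((?s - ?t) \<union> (?t - ?s))"
      have "u \<in> (?s - ?t) \<union> (?t - ?s)" unfolding u_def using ne by (intro Max_in) auto
      moreover have "v \<in> ?s \<longleftrightarrow> v \<in> ?t" if "v > u" for v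
      proof (rule ccontr)
        assume "\<not> ?thesis"
        then have "v \<le> u" unfolding u_def by (intro Max_ge) auto
        then show False using that by simp
      qed
      ultimately show False
        using main[OF ij ab eq, of u] main[OF ij(2,1) ab(2,1) eq[symmetric], of u] by blast
    qed
  qed (use ab Y len in \<open>auto intro: sorted_nths simp: Z_def\<close>)
  moreover have "Z \<subseteq> Y" by (auto simp: Z_def)
  ultimately show thesis using Y(1) c by (intro that[of Z c I]) blast+
qed

end

section \<open>Finite networks in a probability algebra\<close>

interpretation Meet: comm_monoid_set inf "top :: 'b::boolean_algebra"
  by standard (auto simp: ac_simps)

abbreviation Meet where "Meet \<equiv> Meet.F"

text \<open>For \<open>A \<subseteq> D\<close> these are the atoms of the subalgebra generated by
  \<open>D\<close>, except that some may be \<open>bot\<close>.\<close>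

definition atom_of :: "'b::boolean_algebra set \<Rightarrow> 'b set \<Rightarrow> 'b" where
  "atom_of D A = Meet (\<lambda>x. if x \<in> A then x else - x) D"

lemma atom_of_empty [simp]: "atom_of {} A = top"
  by (simp add: atom_of_def)

lemma atom_of_insert: "finite D \<Longrightarrow> x \<notin> D \<Longrightarrow> atom_of (insert x D) A = inf (if x \<in> A then x else - x) (atom_of D A)"
  by (simp add: atom_of_def)

lemma atom_of_cong: "A \<inter> D = B \<inter> D \<Longrightarrow> atom_of D A = atom_of D B"
  unfolding atom_of_def by (rule Meet.cong) auto

lemma sum_Pow_insert:
  assumes "finite D" "x \<notin> D"
  shows "(\<Sum>A\<in>Pow (insert x D). f A) = (\<Sum>A\<in>Pow D. f (insert x A) + f A)"
proof -
  have "inj_on (insert x) (Pow D)" using assms(2) by (auto simp: inj_on_def)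
  then have "(\<Sum>A\<in>insert x ` Pow D. f A) = (\<Sum>A\<in>Pow D. f (insert x A))" by (simp add: sum.reindex)
  moreover have "Pow D \<inter> insert x ` Pow D = {}" using assms(2) by auto
  ultimately show ?thesis using assms(1) by (simp add: Pow_insert sum.union_disjoint sum.distrib add.commute)
qed

section \<open>Conditional probabilities and energy\<close>

locale boolean_prob =
  fixes \<nu> :: "'b::boolean_algebra \<Rightarrow> real"
  assumes nonneg: "\<And>x. \<nu> x \<ge> 0"
    and total: "\<nu> top = 1"
    and additive: "\<And>x y. inf x y = bot \<Longrightarrow> \<nu> (sup x y) = \<nu> x + \<nu> y"
begin

lemma split: "\<nu> x = \<nu> (inf y x) + \<nu> (inf (- y) x)"
proof -
  have "inf (inf y x) (inf (- y) x) = bot" by (simp add: inf_left_commute inf_commute inf_assoc)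
  moreover have "sup (inf y x) (inf (- y) x) = x" by (simp add: inf_sup_distrib2[symmetric])
  ultimately show ?thesis using additive by metis
qed

lemma inf_le: "\<nu> (inf x y) \<le> \<nu> y"
  using split[of y x] nonneg by (metis add_increasing2 order_refl)

text \<open>Adding a generator outside \<open>D\<close> splits each atom in two and leaves
  \<open>A \<inter> D\<close> unchanged, so a weight that depends on \<open>A \<inter> D\<close>
  only does not see the refinement.\<close>

lemma sum_atoms:
  assumes "finite D'" "D \<subseteq> D'"
  shows "(\<Sum>A\<in>Pow D'. \<nu> (inf c (atom_of D' A)) * \<psi> (A \<inter> D)) = (\<Sum>A\<in>Pow D. \<nu> (inf c (atom_of D A)) * \<psi> A)"
proof -
  have "finite D" using assms finite_subset by blast
  have "(\<Sum>A\<in>Pow (D \<union> E). \<nu> (inf c (atom_of (D \<union> E) A)) * \<psi> (A \<inter> D)) = (\<Sum>A\<in>Pow D. \<nu> (inf c (atom_of D A)) * \<psi> A)"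
    if "finite E" "D \<inter> E = {}" for E
    using that
  proof (induction E rule: finite_induct)
    case empty
    show ?case by (auto intro!: sum.cong simp: Int_absorb2)
  next
    case (insert x E)
    let ?D = "D \<union> E"
    have x: "x \<notin> ?D" "finite ?D" using insert \<open>finite D\<close> by auto
    have "(\<Sum>A\<in>Pow (insert x ?D). \<nu> (inf c (atom_of (insert x ?D) A)) * \<psi> (A \<inter> D)) =
      (\<Sum>A\<in>Pow ?D. \<nu> (inf c (atom_of ?D A)) * \<psi> (A \<inter> D))"
      unfolding sum_Pow_insert[OF x(2,1)]
    proof (rule sum.cong[OF refl])
      fix A assume A: "A \<in> Pow ?D"
      have 1: "atom_of ?D (insert x A) = atom_of ?D A" by (rule atom_of_cong) (use x in auto)
      have 2: "x \<notin> A" "insert x A \<inter> D = A \<inter> D" using A x insert by auto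
      show "\<nu> (inf c (atom_of (insert x ?D) (insert x A))) * \<psi> (insert x A \<inter> D) +
         \<nu> (inf c (atom_of (insert x ?D) A)) * \<psi> (A \<inter> D) = \<nu> (inf c (atom_of ?D A)) * \<psi> (A \<inter> D)"
        using split[of "inf c (atom_of ?D A)" x]
        by (simp add: atom_of_insert[OF x(2,1)] 1 2 inf_left_commute distrib_right[symmetric])
    qed
    then show ?case using insert by simp
  qed
  from this[of "D' - D"] show ?thesis using assms by (simp add: Un_absorb1)
qed

text \<open>On atoms of measure \<open>0\<close> this is \<open>x / 0 = 0\<close>.\<close>

definition cond :: "'b \<Rightarrow> 'b set \<Rightarrow> 'b set \<Rightarrow> real" where
  "cond b D A = \<nu> (inf b (atom_of D A)) / \<nu> (atom_of D A)"

definition energy :: "'b \<Rightarrow> 'b set \<Rightarrow> real" where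
  "energy b D = (\<Sum>A\<in>Pow D. \<nu> (inf b (atom_of D A)) * cond b D A)"

text \<open>On a null atom both sides are \<open>0\<close>, by monotonicity of \<nu>; this is why
  the convention for division by \<open>0\<close> does no harm.\<close>

lemma cond_mult: "\<nu> (atom_of D A) * cond b D A = \<nu> (inf b (atom_of D A))"
  using inf_le[of b "atom_of D A"] nonneg[of "inf b (atom_of D A)"] by (auto simp: cond_def)

lemma cond_bounds: "0 \<le> cond b D A" "cond b D A \<le> 1"
  using inf_le[of b "atom_of D A"] nonneg by (auto simp: cond_def divide_le_eq_1 order_less_le)

lemma sum_atoms_top: "finite D \<Longrightarrow> (\<Sum>A\<in>Pow D. \<nu> (inf c (atom_of D A))) = \<nu> c"
  using sum_atoms[of D "{}" c "\<lambda>_. 1"] by simp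

lemma sum_atoms_1: "finite D \<Longrightarrow> (\<Sum>A\<in>Pow D. \<nu> (atom_of D A)) = 1"
  using sum_atoms_top[of D top] total by simp

lemma energy_le: "finite D \<Longrightarrow> energy b D \<le> 1"
proof -
  assume D: "finite D"
  have "energy b D \<le> (\<Sum>A\<in>Pow D. \<nu> (atom_of D A))"
    unfolding energy_def
  proof (rule sum_mono)
    fix A
    have "\<nu> (inf b (atom_of D A)) * cond b D A \<le> \<nu> (inf b (atom_of D A)) * 1"
      by (intro mult_left_mono cond_bounds nonneg)
    then show "\<nu> (inf b (atom_of D A)) * cond b D A \<le> \<nu> (atom_of D A)" using inf_le[of b "atom_of D A"] by linarith
  qed
  then show ?thesis using sum_atoms_1[OF D] by simp
qed

text \<open>Conditional expectation is an orthogonal projection, so the energy is its squared norm.\<close>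

lemma energy_diff:
  assumes "finite D'" "D \<subseteq> D'"
  shows "(\<Sum>A\<in>Pow D'. \<nu> (atom_of D' A) * (cond b D' A - cond b D (A \<inter> D))\<^sup>2) = energy b D' - energy b D"
proof -
  have "(\<Sum>A\<in>Pow D'. \<nu> (atom_of D' A) * (cond b D' A - cond b D (A \<inter> D))\<^sup>2) =
    (\<Sum>A\<in>Pow D'. \<nu> (inf b (atom_of D' A)) * cond b D' A
      - 2 * (\<nu> (inf b (atom_of D' A)) * cond b D (A \<inter> D)) + \<nu> (inf top (atom_of D' A)) * (cond b D (A \<inter> D))\<^sup>2)"
    by (intro sum.cong refl) (simp add: power2_eq_square algebra_simps cond_mult[symmetric])
  also have "\<dots> = energy b D' - 2 * energy b D + (\<Sum>A\<in>Pow D. \<nu> (inf top (atom_of D A)) * (cond b D A)\<^sup>2)"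
    using sum_atoms[OF assms, of b "cond b D"] sum_atoms[OF assms, of top "\<lambda>A. (cond b D A)\<^sup>2"]
    by (simp add: sum.distrib sum_subtractf sum_distrib_left[symmetric] energy_def)
  also have "(\<Sum>A\<in>Pow D. \<nu> (inf top (atom_of D A)) * (cond b D A)\<^sup>2) = energy b D"
    unfolding energy_def by (intro sum.cong refl) (simp add: power2_eq_square cond_mult[symmetric])
  finally show ?thesis by simp
qed

lemma energy_mono: "finite D' \<Longrightarrow> D \<subseteq> D' \<Longrightarrow> energy b D \<le> energy b D'"
  using energy_diff[of D' D b] sum_nonneg[of "Pow D'" "\<lambda>A. \<nu> (atom_of D' A) * (cond b D' A - cond b D (A \<inter> D))\<^sup>2"] nonneg
  by simp

text \<open>By \<open>energy_diff\<close> the energy gain is a squared L2 distance, and under a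
  probability the L1 norm is at most the L2 norm.\<close>

lemma cond_L1_le:
  assumes "finite D'" "D \<subseteq> D'" "energy b D' \<le> energy b D + e\<^sup>2" "e \<ge> 0"
  shows "(\<Sum>A\<in>Pow D'. \<nu> (atom_of D' A) * \<bar>cond b D' A - cond b D (A \<inter> D)\<bar>) \<le> e"
proof -
  define w t where "w A = \<nu> (atom_of D' A)" and "t A = \<bar>cond b D' A - cond b D (A \<inter> D)\<bar>" for A
  define m where "m = (\<Sum>A\<in>Pow D'. w A * t A)"
  have w1: "(\<Sum>A\<in>Pow D'. w A) = 1" using sum_atoms_1[OF assms(1)] by (simp add: w_def)
  have "0 \<le> (\<Sum>A\<in>Pow D'. w A * (t A - m)\<^sup>2)" using nonneg by (intro sum_nonneg) (simp add: w_def)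
  also have "\<dots> = (\<Sum>A\<in>Pow D'. w A * (t A)\<^sup>2 - 2 * m * (w A * t A) + m\<^sup>2 * w A)"
    by (intro sum.cong refl) (simp add: power2_eq_square algebra_simps)
  also have "\<dots> = (\<Sum>A\<in>Pow D'. w A * (t A)\<^sup>2) - 2 * m * m + m\<^sup>2"
    by (simp add: sum.distrib sum_subtractf sum_distrib_left[symmetric] w1 m_def[symmetric])
  also have "(\<Sum>A\<in>Pow D'. w A * (t A)\<^sup>2) = energy b D' - energy b D"
    using energy_diff[OF assms(1,2), of b] by (simp add: w_def t_def)
  finally have "m\<^sup>2 \<le> e\<^sup>2" using assms(3) by (simp add: power2_eq_square)
  then have "m \<le> e" using assms(4) power2_le_imp_le by blast
  then show ?thesis by (simp add: m_def w_def t_def)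
qed

end

locale ordered_boolean_prob = boolean_prob \<nu> for \<nu> :: "'b::boolean_algebra \<Rightarrow> real" +
  fixes lt :: "'b::boolean_algebra \<Rightarrow> 'b \<Rightarrow> bool"
  assumes wf_lt: "wfp lt"
    and trans_lt: "\<And>x y z. lt x y \<Longrightarrow> lt y z \<Longrightarrow> lt x z"
    and total_lt: "\<And>x y. x \<noteq> y \<Longrightarrow> lt x y \<or> lt y x"
begin

lemma irrefl_lt: "\<not> lt x x"
  using wf_lt by (meson wfp_imp_irreflp irreflpD)

abbreviation descending :: "'b list \<Rightarrow> bool" where
  "descending \<equiv> sorted_wrt (\<lambda>x y. lt y x)"

lemma descending_distinct: "descending L \<Longrightarrow> distinct L"
  by (induction L) (auto simp: irrefl_lt)

lemma descending_unique: "descending L \<Longrightarrow> descending M \<Longrightarrow> set L = set M \<Longrightarrow> L = M"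
proof (induction L arbitrary: M)
  case (Cons x L)
  then obtain y M' where M: "M = y # M'" by (cases M) auto
  have "x = y" using Cons.prems M irrefl_lt trans_lt by (metis list.set_intros(1) set_ConsD sorted_wrt.simps(2))
  moreover have "set L = set M'"
    using Cons.prems M \<open>x = y\<close> irrefl_lt by (auto simp: set_eq_iff) (metis insertE insertI1)+
  ultimately show ?case using Cons M by auto
qed simp

lemma finite_descending: "finite D \<Longrightarrow> \<exists>L. descending L \<and> set L = D"
proof (induction "card D" arbitrary: D)
  case (Suc n)
  have "\<exists>x\<in>D. \<forall>y\<in>D. y \<noteq> x \<longrightarrow> lt y x" if "finite D" "D \<noteq> {}" for D
    using that
  proof (induction D rule: finite_ne_induct)
    case (insert a D)
    then show ?case using total_lt trans_lt by (metis insert_iff)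
  qed simp
  then obtain x where x: "x \<in> D" "\<And>y. y \<in> D \<Longrightarrow> y \<noteq> x \<Longrightarrow> lt y x" using Suc by (metis card.empty nat.distinct(1))
  obtain L where L: "descending L" "set L = D - {x}" using Suc x by (metis card_Diff_singleton diff_Suc_1 finite_Diff)
  then have "descending (x # L)" "set (x # L) = D" using x by auto
  then show ?case by blast
qed auto

text \<open>A list is a network with error \<open>d\<close> if each entry is, given the later entries of the list,
  almost independent of everything else that precedes it in the well-order.\<close>

fun network :: "real \<Rightarrow> 'b list \<Rightarrow> bool" where
  "network d [] \<longleftrightarrow> d \<ge> 0"
| "network d (b # L) \<longleftrightarrow> (\<forall>x\<in>set L. lt x b) \<and> (\<exists>e\<ge>0. network (d - e) L \<and>
     (\<forall>D. finite D \<longrightarrow> (\<forall>x\<in>D. lt x b) \<longrightarrow> set L \<subseteq> D \<longrightarrow> energy b D \<le> energy b (set L) + e\<^sup>2))"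

lemma network_descending: "network d L \<Longrightarrow> descending L"
  by (induction L arbitrary: d) auto

lemma almost_max_energy:
  assumes "e > 0"
  shows "\<exists>D0. finite D0 \<and> (\<forall>x\<in>D0. lt x b) \<and>
    (\<forall>L D. D0 \<subseteq> L \<longrightarrow> L \<subseteq> D \<longrightarrow> finite D \<longrightarrow> (\<forall>x\<in>D. lt x b) \<longrightarrow> energy b D \<le> energy b L + e)"
proof -
  define \<D> where "\<D> = {D. finite D \<and> (\<forall>x\<in>D. lt x b)}"
  define s where "s = Sup (energy b ` \<D>)"
  have bdd: "bdd_above (energy b ` \<D>)" using energy_le by (auto simp: \<D>_def bdd_above_def)
  have "energy b ` \<D> \<noteq> {}" by (auto simp: \<D>_def)
  then obtain D0 where D0: "D0 \<in> \<D>" "energy b D0 > s - e"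
    using less_cSup_iff[OF _ bdd, of "s - e"] assms by (auto simp: s_def)
  have "energy b D \<le> energy b L + e" if "D0 \<subseteq> L" "L \<subseteq> D" "finite D" "\<forall>x\<in>D. lt x b" for L D
  proof -
    have "energy b D \<le> s" unfolding s_def using that by (intro cSUP_upper bdd) (simp add: \<D>_def)
    moreover have "energy b D0 \<le> energy b L" using that finite_subset by (blast intro: energy_mono)
    ultimately show ?thesis using D0 by linarith
  qed
  then show ?thesis using D0(1) by (auto simp: \<D>_def)
qed

lemma network_extend:
  assumes "\<And>D \<delta>. finite D \<Longrightarrow> (\<forall>x\<in>D. lt x b) \<Longrightarrow> \<delta> > 0 \<Longrightarrow> \<exists>L. D \<subseteq> set L \<and> (\<forall>x\<in>set L. lt x b) \<and> network \<delta> L"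
    and "finite D" "\<forall>x\<in>D. lt x b" "\<delta> > 0"
  shows "\<exists>L. D \<subseteq> set L \<and> network \<delta> (b # L)"
proof -
  obtain D0 where D0: "finite D0" "\<forall>x\<in>D0. lt x b"
    "\<And>L D. D0 \<subseteq> L \<Longrightarrow> L \<subseteq> D \<Longrightarrow> finite D \<Longrightarrow> (\<forall>x\<in>D. lt x b) \<Longrightarrow> energy b D \<le> energy b L + (\<delta>/2)\<^sup>2"
    using almost_max_energy[of "(\<delta>/2)\<^sup>2" b] assms(4) by auto
  obtain L where L: "D \<union> D0 \<subseteq> set L" "\<forall>x\<in>set L. lt x b" "network (\<delta>/2) L"
    using assms(1)[of "D \<union> D0" "\<delta>/2"] assms(2-4) D0(1,2) by (metis Un_iff finite_UnI half_gt_zero)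
  have "network \<delta> (b # L)"
    unfolding network.simps using L D0(3) assms(4) by (intro conjI exI[of _ "\<delta>/2"]) auto
  then show ?thesis using L by auto
qed

lemma network_below:
  "finite D \<Longrightarrow> (\<forall>x\<in>D. lt x b) \<Longrightarrow> \<delta> > 0 \<Longrightarrow> \<exists>L. D \<subseteq> set L \<and> (\<forall>x\<in>set L. lt x b) \<and> network \<delta> L"
  using wf_lt
proof (induction b arbitrary: D \<delta> rule: wfp_induct_rule)
  case (less b)
  obtain M where M: "descending M" "set M = D" using finite_descending less.prems(1) by blast
  show ?case
  proof (cases M)
    case Nil
    then show ?thesis using M less.prems by (intro exI[of _ "[]"]) auto
  next
    case (Cons c M')
    have c: "lt c b" "finite (set M')" "\<forall>x\<in>set M'. lt x c" using Cons M less.prems by auto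
    from network_extend[OF less.IH[OF c(1)] c(2,3) less.prems(3)]
    obtain L where L: "set M' \<subseteq> set L" "network \<delta> (c # L)" by blast
    then have "\<forall>x\<in>set (c # L). lt x b" using c(1) trans_lt by auto
    then show ?thesis using L M Cons by (intro exI[of _ "c # L"]) auto
  qed
qed

lemma network_exists: "\<delta> > 0 \<Longrightarrow> \<exists>L. network \<delta> (b # L)"
  using network_extend[of b "{}" \<delta>] network_below[of _ b] by auto

end

section \<open>Averages over independent variables\<close>

definition avg1 :: "nat \<Rightarrow> 's \<Rightarrow> (('s \<Rightarrow> nat) \<Rightarrow> real) \<Rightarrow> ('s \<Rightarrow> nat) \<Rightarrow> real" where
  "avg1 Q x f z = (\<Sum>v<Q. f (z(x := v))) / Q"

definition avg :: "nat \<Rightarrow> 's set \<Rightarrow> (('s \<Rightarrow> nat) \<Rightarrow> real) \<Rightarrow> ('s \<Rightarrow> nat) \<Rightarrow> real" where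
  "avg Q T f = Finite_Set.fold (avg1 Q) f T"

definition depends_on :: "(('s \<Rightarrow> nat) \<Rightarrow> real) \<Rightarrow> 's set \<Rightarrow> bool" where
  "depends_on f K \<longleftrightarrow> (\<forall>z w. (\<forall>x\<in>K. z x = w x) \<longrightarrow> f z = f w)"

lemma avg1_commute: "avg1 Q x (avg1 Q y f) = avg1 Q y (avg1 Q x f)"
proof (cases "x = y")
  case False
  have "(\<Sum>v<Q. \<Sum>w<Q. f (z(x := v, y := w))) = (\<Sum>w<Q. \<Sum>v<Q. f (z(y := w, x := v)))" for z
    using False by (subst sum.swap) (simp add: fun_upd_twist)
  then show ?thesis by (simp add: avg1_def sum_divide_distrib[symmetric] fun_eq_iff)
qed simp

interpretation avg1: comp_fun_commute "avg1 Q"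
  by standard (simp add: fun_eq_iff avg1_commute)

lemma avg_empty [simp]: "avg Q {} f = f"
  by (simp add: avg_def)

lemma avg_insert: "finite T \<Longrightarrow> x \<notin> T \<Longrightarrow> avg Q (insert x T) f = avg1 Q x (avg Q T f)"
  by (simp add: avg_def)

lemma avg_insert2: "finite T \<Longrightarrow> x \<notin> T \<Longrightarrow> avg Q (insert x T) f = avg Q T (avg1 Q x f)"
  unfolding avg_def by (rule avg1.fold_insert2)

lemma avg_Un: "finite A \<Longrightarrow> finite B \<Longrightarrow> A \<inter> B = {} \<Longrightarrow> avg Q (A \<union> B) f = avg Q A (avg Q B f)"
  by (induction A rule: finite_induct) (auto simp: avg_insert)

lemma depends_onD: "depends_on f K \<Longrightarrow> (\<And>x. x \<in> K \<Longrightarrow> z x = w x) \<Longrightarrow> f z = f w"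
  by (auto simp: depends_on_def)

lemma depends_on_mono: "depends_on f K \<Longrightarrow> K \<subseteq> K' \<Longrightarrow> depends_on f K'"
  unfolding depends_on_def by blast

lemma depends_on_avg1:
  assumes "depends_on f K"
  shows "depends_on (avg1 Q x f) (K - {x})"
  unfolding depends_on_def[of "avg1 Q x f"]
proof (intro allI impI)
  fix z w :: "'a \<Rightarrow> nat" assume *: "\<forall>y\<in>K - {x}. z y = w y"
  have "f (z(x := v)) = f (w(x := v))" for v
    by (rule depends_onD[OF assms]) (use * in simp)
  then show "avg1 Q x f z = avg1 Q x f w" by (simp add: avg1_def)
qed

lemma depends_on_avg: "finite T \<Longrightarrow> depends_on f K \<Longrightarrow> depends_on (avg Q T f) (K - T)"
proof (induction T rule: finite_induct)
  case (insert x T)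
  show ?case unfolding avg_insert[OF insert.hyps] Diff_insert[of K x T]
    by (rule depends_on_avg1[OF insert.IH[OF insert.prems]])
qed simp

lemma avg1_mono: "(\<And>z. f z \<le> g z) \<Longrightarrow> avg1 Q x f z \<le> avg1 Q x g z"
  by (simp add: avg1_def divide_right_mono sum_mono)

lemma avg_mono: "finite T \<Longrightarrow> (\<And>z. f z \<le> g z) \<Longrightarrow> avg Q T f z \<le> avg Q T g z"
  by (induction T arbitrary: z rule: finite_induct) (auto simp: avg_insert intro: avg1_mono)

lemma avg1_indep: "Q > 0 \<Longrightarrow> depends_on f K \<Longrightarrow> x \<notin> K \<Longrightarrow> avg1 Q x f = f"
proof
  fix z assume "Q > 0" "depends_on f K" "x \<notin> K"
  moreover have "f (z(x := v)) = f z" for v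
    by (rule depends_onD[OF \<open>depends_on f K\<close>]) (use \<open>x \<notin> K\<close> in auto)
  ultimately show "avg1 Q x f z = f z" by (simp add: avg1_def)
qed

lemma avg_indep: "finite T \<Longrightarrow> Q > 0 \<Longrightarrow> depends_on f K \<Longrightarrow> T \<inter> K = {} \<Longrightarrow> avg Q T f = f"
  by (induction T rule: finite_induct) (auto simp: avg_insert avg1_indep)

lemma avg_superset:
  assumes "finite T" "K \<subseteq> T" "Q > 0" "depends_on f K"
  shows "avg Q T f = avg Q K f"
proof -
  have "avg Q (K \<union> (T - K)) f = avg Q K (avg Q (T - K) f)"
    by (rule avg_Un) (use assms finite_subset in auto)
  also have "avg Q (T - K) f = f" by (rule avg_indep) (use assms in auto)
  finally show ?thesis using assms(2) by (simp add: Un_absorb1)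
qed

lemma avg1_mult_indep:
  assumes "depends_on f K" "x \<notin> K"
  shows "avg1 Q x (\<lambda>z. f z * g z) = (\<lambda>z. f z * avg1 Q x g z)"
proof
  fix z
  have "f (z(x := v)) = f z" for v by (rule depends_onD[OF assms(1)]) (use assms(2) in auto)
  then show "avg1 Q x (\<lambda>z. f z * g z) z = f z * avg1 Q x g z"
    by (simp add: avg1_def sum_distrib_left)
qed

lemma avg_mult_indep:
  assumes "finite T" "depends_on f K" "T \<inter> K = {}"
  shows "avg Q T (\<lambda>z. f z * g z) = (\<lambda>z. f z * avg Q T g z)"
  using assms(1,3) by (induction T rule: finite_induct) (auto simp: avg_insert avg1_mult_indep[OF assms(2)])

lemma avg_prod:
  fixes f :: "'u \<Rightarrow> ('s \<Rightarrow> nat) \<Rightarrow> real"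
  assumes "finite U" "\<And>u. u \<in> U \<Longrightarrow> finite (B u)"
    "\<And>u v. u \<in> U \<Longrightarrow> v \<in> U \<Longrightarrow> u \<noteq> v \<Longrightarrow> B u \<inter> B v = {}"
    "\<And>u. u \<in> U \<Longrightarrow> depends_on (f u) (A \<union> B u)" "\<And>u. u \<in> U \<Longrightarrow> A \<inter> B u = {}"
  shows "avg Q (\<Union>u\<in>U. B u) (\<lambda>z. \<Prod>u\<in>U. f u z) = (\<lambda>z. \<Prod>u\<in>U. avg Q (B u) (f u) z)"
  using assms
proof (induction U rule: finite_induct)
  case (insert u U)
  have dep: "depends_on (\<lambda>z. \<Prod>u\<in>U. f u z) (A \<union> (\<Union>u\<in>U. B u))"
    unfolding depends_on_def
  proof (intro allI impI prod.cong refl)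
    fix z w :: "'s \<Rightarrow> nat" and v assume "\<forall>x\<in>A \<union> (\<Union>u\<in>U. B u). z x = w x" "v \<in> U"
    then show "f v z = f v w" using depends_onD[OF insert.prems(3)[of v], of z w] by auto
  qed
  have dep2: "depends_on (avg Q (B u) (f u)) A"
    using depends_on_avg[OF insert.prems(1)[of u] insert.prems(3)[of u], of Q] by (auto elim: depends_on_mono)
  have disj: "B u \<inter> B v = {}" "A \<inter> B u = {}" "A \<inter> B v = {}" if "v \<in> U" for v
    using insert.prems(2)[of u v] insert.prems(4)[of u] insert.prems(4)[of v] insert.hyps(2) that by auto
  have "avg Q (\<Union>u\<in>insert u U. B u) (\<lambda>z. \<Prod>u\<in>insert u U. f u z)
     = avg Q ((\<Union>u\<in>U. B u) \<union> B u) (\<lambda>z. (\<Prod>u\<in>U. f u z) * f u z)"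
    using insert.hyps by (simp add: Un_commute mult.commute)
  also have "\<dots> = avg Q (\<Union>u\<in>U. B u) (avg Q (B u) (\<lambda>z. (\<Prod>u\<in>U. f u z) * f u z))"
    by (rule avg_Un) (use insert.hyps insert.prems disj in auto)
  also have "avg Q (B u) (\<lambda>z. (\<Prod>u\<in>U. f u z) * f u z) = (\<lambda>z. (\<Prod>u\<in>U. f u z) * avg Q (B u) (f u) z)"
    by (rule avg_mult_indep[OF _ dep]) (use insert.prems(1,4) disj in \<open>auto simp: disjoint_iff\<close>)
  also have "\<dots> = (\<lambda>z. avg Q (B u) (f u) z * (\<Prod>u\<in>U. f u z))" by (simp add: mult.commute)
  also have "avg Q (\<Union>u\<in>U. B u) \<dots> = (\<lambda>z. avg Q (B u) (f u) z * avg Q (\<Union>u\<in>U. B u) (\<lambda>z. \<Prod>u\<in>U. f u z) z)"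
    by (rule avg_mult_indep[OF _ dep2]) (use insert.hyps insert.prems(1) disj in \<open>auto simp: disjoint_iff\<close>)
  finally show ?case using insert by auto
qed simp

lemma power_mean:
  fixes f :: "nat \<Rightarrow> real"
  assumes "\<And>v. f v \<ge> 0" "Q > 0"
  shows "((\<Sum>v<Q. f v) / Q) ^ m \<le> (\<Sum>v<Q. f v ^ m) / Q"
proof (cases m)
  case (Suc k)
  define a where "a = (\<Sum>v<Q. f v) / Q"
  have a0: "a \<ge> 0" unfolding a_def using assms by (auto intro!: divide_nonneg_nonneg sum_nonneg)
  have tangent: "x ^ m \<ge> a ^ m + real m * a ^ k * (x - a)" if "x \<ge> 0" for x :: real
  proof -
    have sign: "(x - a) * (x ^ i - a ^ i) \<ge> 0" for i
      using power_mono[of a x i] power_mono[of x a i] that a0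
      by (cases "x \<ge> a") (auto intro: mult_nonneg_nonneg mult_nonpos_nonpos)
    have "x ^ Suc k - a ^ Suc k - real (Suc k) * a ^ k * (x - a) \<ge> 0"
    proof (induction k)
      case (Suc j)
      have "x ^ Suc (Suc j) - a ^ Suc (Suc j) - real (Suc (Suc j)) * a ^ Suc j * (x - a) =
        a * (x ^ Suc j - a ^ Suc j - real (Suc j) * a ^ j * (x - a)) + (x - a) * (x ^ Suc j - a ^ Suc j)"
        by (simp add: algebra_simps)
      then show ?case using Suc a0 sign[of "Suc j"] by (metis add_nonneg_nonneg mult_nonneg_nonneg)
    qed simp
    then show ?thesis using Suc by simp
  qed
  have "(\<Sum>v<Q. f v) = Q * a" unfolding a_def using assms by simp
  then have "Q * a ^ m = (\<Sum>v<Q. a ^ m + real m * a ^ k * (f v - a))"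
    by (simp add: sum.distrib sum_distrib_left[symmetric] sum_subtractf)
  also have "\<dots> \<le> (\<Sum>v<Q. f v ^ m)" by (intro sum_mono tangent assms)
  finally show ?thesis using assms(2) by (simp add: a_def[symmetric] field_simps)
qed (use assms in simp)

lemma avg_nonneg: "finite T \<Longrightarrow> (\<And>z. f z \<ge> 0) \<Longrightarrow> avg Q T f z \<ge> 0"
  by (induction T arbitrary: z rule: finite_induct)
    (auto simp: avg_insert avg1_def intro!: divide_nonneg_nonneg sum_nonneg)

lemma avg_power:
  assumes "finite T" "Q > 0" "\<And>z. f z \<ge> 0"
  shows "avg Q T f z ^ m \<le> avg Q T (\<lambda>z. f z ^ m) z"
  using assms(1)
proof (induction T arbitrary: z rule: finite_induct)
  case (insert x T)
  have "avg1 Q x (avg Q T f) z ^ m \<le> avg1 Q x (\<lambda>z. avg Q T f z ^ m) z"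
    unfolding avg1_def using insert assms by (intro power_mean avg_nonneg) auto
  also have "\<dots> \<le> avg1 Q x (avg Q T (\<lambda>z. f z ^ m)) z" using insert by (intro avg1_mono) auto
  finally show ?case using insert by (simp add: avg_insert)
qed (use assms in simp)

lemma avg_rename:
  fixes \<iota> :: "'t \<Rightarrow> 's"
  assumes "finite T" "inj_on \<iota> K" "T \<subseteq> K" "depends_on f K"
  shows "avg Q (\<iota> ` T) (\<lambda>z. f (z \<circ> \<iota>)) z = avg Q T f (z \<circ> \<iota>)"
  using assms(1,3)
proof (induction T arbitrary: z rule: finite_induct)
  case (insert x T)
  have dep: "depends_on (avg Q T f) K"
    using depends_on_avg[OF insert.hyps(1) assms(4)] by (rule depends_on_mono) auto
  have "\<iota> x \<notin> \<iota> ` T" using insert assms(2) by (auto simp: inj_on_def)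
  then have "avg Q (\<iota> ` insert x T) (\<lambda>z. f (z \<circ> \<iota>)) = avg1 Q (\<iota> x) (avg Q (\<iota> ` T) (\<lambda>z. f (z \<circ> \<iota>)))"
    unfolding image_insert by (rule avg_insert[rotated]) (use insert in simp)
  moreover have "avg Q (\<iota> ` T) (\<lambda>z. f (z \<circ> \<iota>)) = (\<lambda>z. avg Q T f (z \<circ> \<iota>))"
    by (intro ext insert.IH) (use insert.prems in simp)
  ultimately have "avg Q (\<iota> ` insert x T) (\<lambda>z. f (z \<circ> \<iota>)) z = avg1 Q (\<iota> x) (\<lambda>z. avg Q T f (z \<circ> \<iota>)) z"
    by simp
  also have "\<dots> = avg1 Q x (avg Q T f) (z \<circ> \<iota>)"
    unfolding avg1_def
  proof (intro arg_cong2[where f="(/)"] sum.cong refl depends_onD[OF dep])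
    fix v y assume "y \<in> K"
    then show "(z(\<iota> x := v) \<circ> \<iota>) y = ((z \<circ> \<iota>)(x := v)) y"
      using insert.prems assms(2) by (auto simp: inj_on_def)
  qed
  finally show ?case unfolding avg_insert[OF insert.hyps] .
qed simp

definition grid_index :: "nat \<Rightarrow> (nat \<Rightarrow> nat set) \<Rightarrow> 'k list set \<Rightarrow> (nat \<times> 'k list) set" where
  "grid_index k I G = {(i, nths a (I i)) | i a. i < k \<and> a \<in> G}"

definition grid_event :: "nat \<Rightarrow> nat list set \<Rightarrow> (nat \<Rightarrow> nat set) \<Rightarrow> 'k list set \<Rightarrow> (nat \<times> 'k list \<Rightarrow> nat) \<Rightarrow> real" where
  "grid_event k H I G z = (\<Prod>a\<in>G. of_bool (map (\<lambda>i. z (i, nths a (I i))) [0..<k] \<in> H))"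

lemma depends_on_grid_event:
  fixes G :: "'k list set"
  shows "depends_on (grid_event k H I G) (grid_index k I G)"
  unfolding depends_on_def grid_event_def
proof (intro allI impI prod.cong refl)
  fix z w :: "nat \<times> 'k list \<Rightarrow> nat" and a assume "\<forall>x\<in>grid_index k I G. z x = w x" "a \<in> G"
  then have "map (\<lambda>i. z (i, nths a (I i))) [0..<k] = map (\<lambda>i. w (i, nths a (I i))) [0..<k]"
    unfolding grid_index_def by (intro map_cong refl) (force simp: Ball_def)
  then show "of_bool (map (\<lambda>i. z (i, nths a (I i))) [0..<k] \<in> H) = (of_bool (map (\<lambda>i. w (i, nths a (I i))) [0..<k] \<in> H) :: real)"
    by (simp only:)
qed

lemma finite_grid_index: "finite G \<Longrightarrow> finite (grid_index k I G)"
proof -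
  assume "finite G"
  moreover have "grid_index k I G = (\<lambda>(i, a). (i, nths a (I i))) ` ({..<k} \<times> G)" by (auto simp: grid_index_def)
  ultimately show ?thesis by simp
qed

lemma set_Cons_image: "set_Cons A X = (\<lambda>(x, xs). x # xs) ` (A \<times> X)"
  by (auto simp: set_Cons_def)

lemma finite_listset: "(\<And>A. A \<in> set As \<Longrightarrow> finite A) \<Longrightarrow> finite (listset As)"
  by (induction As) (auto simp: set_Cons_image)

lemma card_listset: "card (listset As) = (\<Prod>A\<leftarrow>As. card A)"
proof (induction As)
  case (Cons A As)
  have "inj_on (\<lambda>(x, xs). x # xs) (A \<times> listset As)" by (auto simp: inj_on_def)
  then show ?case using Cons by (simp add: set_Cons_image card_image card_cartesian_product)
qed simp

lemma grid_event_nonneg: "grid_event k H I G z \<ge> 0"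
  unfolding grid_event_def by (intro prod_nonneg) auto

lemma grid_event_le_1: "grid_event k H I G z \<le> 1"
  unfolding grid_event_def by (intro prod_le_1) auto

text \<open>Fixing the first coordinate of a grid \<open>A \<times> G\<close> gives \<open>card A\<close> copies of \<open>G\<close>, which are
  independent and identically distributed given the variables that do not involve that coordinate.
  By Jensen's inequality, the density of the grid is at least the density of \<open>G\<close> to the power
  \<open>card A\<close>.\<close>

lemma grid_density:
  fixes As :: "'k set list"
  assumes Q: "Q > 0" and \<rho>: "\<rho> \<ge> 0"
    and base: "\<And>z. avg Q ({..<k} \<times> {[]}) (\<lambda>z. of_bool (map (\<lambda>i. z (i, [] :: 'k list)) [0..<k] \<in> H)) z \<ge> \<rho>"
    and "\<And>A. A \<in> set As \<Longrightarrow> finite A"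
  shows "avg Q (grid_index k I (listset As)) (grid_event k H I (listset As)) z \<ge> \<rho> ^ card (listset As)"
  using assms(4)
proof (induction As arbitrary: I z)
  case Nil
  have "grid_index k I {[] :: 'k list} = {..<k} \<times> {[]}" by (auto simp: grid_index_def)
  then show ?case using base by (simp add: grid_event_def[abs_def])
next
  case (Cons A As)
  define I' where "I' i = {j. Suc j \<in> I i}" for i
  define K where "K = grid_index k I' (listset As)"
  define K0 where "K0 = {(i, s)\<in>K. 0 \<notin> I i}"
  define K1 where "K1 = {(i, s)\<in>K. 0 \<in> I i}"
  define f where "f = grid_event k H I' (listset As)"
  define \<pi> where "\<pi> u = (\<lambda>(i, s). (i, if 0 \<in> I i then u # s else s))" for u :: 'k
  have fin: "finite A" "finite K" using Cons.prems finite_listset[of As] by (auto simp: K_def intro: finite_grid_index)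
  then have finK: "finite K0" "finite K1" unfolding K0_def K1_def by (auto intro: finite_subset[of _ K])
  have KU: "K = K0 \<union> K1" by (auto simp: K0_def K1_def)
  have dep: "depends_on f K" unfolding f_def K_def by (rule depends_on_grid_event)
  have inj: "inj (\<pi> u)" for u by (auto simp: inj_def \<pi>_def split: if_splits)
  have nths: "(i, nths (u # a) (I i)) = \<pi> u (i, nths a (I' i))" for i u a
    by (simp add: nths_Cons \<pi>_def I'_def)
  have event: "grid_event k H I (listset (A # As)) = (\<lambda>z. \<Prod>u\<in>A. f (z \<circ> \<pi> u))"
  proof
    fix z
    have inj: "inj_on (\<lambda>(x, xs). x # xs) (A \<times> listset As)" by (auto simp: inj_on_def)
    show "grid_event k H I (listset (A # As)) z = (\<Prod>u\<in>A. f (z \<circ> \<pi> u))"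
      unfolding grid_event_def f_def listset.simps set_Cons_image prod.reindex[OF inj]
      by (simp add: nths prod.cartesian_product case_prod_unfold)
  qed
  have index: "grid_index k I (listset (A # As)) = (\<Union>u\<in>A. \<pi> u ` K)"
    unfolding grid_index_def K_def by (auto simp: set_Cons_def nths image_iff) (metis nths)+
  show ?case
  proof (cases "A = {}")
    case True
    then show ?thesis using event index by (simp add: set_Cons_def grid_event_def)
  next
    case False
    have "\<pi> u ` K0 = K0" for u by (force simp: K0_def \<pi>_def image_iff)
    then have index': "grid_index k I (listset (A # As)) = K0 \<union> (\<Union>u\<in>A. \<pi> u ` K1)"
      unfolding index KU image_Un using False by auto
    have disj: "K0 \<inter> \<pi> u ` K1 = {}" for u by (auto simp: K0_def K1_def \<pi>_def)
    have disj2: "\<pi> u ` K1 \<inter> \<pi> v ` K1 = {}" if "u \<noteq> v" for u v using that by (auto simp: K1_def \<pi>_def)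
    have dep_u: "depends_on (\<lambda>z. f (z \<circ> \<pi> u)) (K0 \<union> \<pi> u ` K1)" for u
      unfolding depends_on_def
    proof (intro allI impI depends_onD[OF dep])
      fix z w y assume *: "\<forall>x\<in>K0 \<union> \<pi> u ` K1. z x = w x" "y \<in> K"
      then show "(z \<circ> \<pi> u) y = (w \<circ> \<pi> u) y" using \<open>\<And>u. \<pi> u ` K0 = K0\<close>[of u] KU by (auto simp: image_iff)
    qed
    have g: "avg Q (\<pi> u ` K1) (\<lambda>z. f (z \<circ> \<pi> u)) z = avg Q K1 f z" for u z
    proof -
      have "avg Q (\<pi> u ` K1) (\<lambda>z. f (z \<circ> \<pi> u)) z = avg Q K1 f (z \<circ> \<pi> u)"
        by (rule avg_rename[OF finK(2), of _ K]) (use inj_on_subset[OF inj] KU dep in auto)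
      also have "\<dots> = avg Q K1 f z"
      proof (rule depends_onD[OF depends_on_avg[OF finK(2) dep]])
        fix x assume "x \<in> K - K1"
        then have "x \<in> K0" using KU by auto
        then show "(z \<circ> \<pi> u) x = z x" by (auto simp: K0_def \<pi>_def)
      qed
      finally show ?thesis .
    qed
    have "avg Q (grid_index k I (listset (A # As))) (grid_event k H I (listset (A # As))) z =
      avg Q K0 (avg Q (\<Union>u\<in>A. \<pi> u ` K1) (\<lambda>z. \<Prod>u\<in>A. f (z \<circ> \<pi> u))) z"
      unfolding index' event by (subst avg_Un) (use finK fin disj in auto)
    also have "avg Q (\<Union>u\<in>A. \<pi> u ` K1) (\<lambda>z. \<Prod>u\<in>A. f (z \<circ> \<pi> u)) = (\<lambda>z. \<Prod>u\<in>A. avg Q (\<pi> u ` K1) (\<lambda>z. f (z \<circ> \<pi> u)) z)"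
      by (rule avg_prod[where A = K0]) (use fin finK disj disj2 dep_u in auto)
    also have "\<dots> = (\<lambda>z. avg Q K1 f z ^ card A)" by (simp add: g)
    finally have "avg Q (grid_index k I (listset (A # As))) (grid_event k H I (listset (A # As))) z =
      avg Q K0 (\<lambda>z. avg Q K1 f z ^ card A) z" .
    moreover have "avg Q K0 (avg Q K1 f) z ^ card A \<le> avg Q K0 (\<lambda>z. avg Q K1 f z ^ card A) z"
      by (intro avg_power finK Q avg_nonneg) (simp add: f_def grid_event_nonneg)
    moreover have "avg Q K0 (avg Q K1 f) = avg Q K f"
      unfolding KU by (rule avg_Un[symmetric]) (use finK in \<open>auto simp: K0_def K1_def\<close>)
    moreover have "\<rho> ^ card (listset As) \<le> avg Q K f z" unfolding K_def f_def by (rule Cons) (use Cons.prems in auto)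
    ultimately have "(\<rho> ^ card (listset As)) ^ card A \<le> avg Q (grid_index k I (listset (A # As))) (grid_event k H I (listset (A # As))) z"
      using \<rho> by (smt (verit) power_mono zero_le_power)
    then show ?thesis by (simp add: card_listset power_mult[symmetric] mult.commute del: listset.simps)
  qed
qed

section \<open>Coupling networks with independent variables\<close>

definition overlap :: "real \<Rightarrow> nat \<Rightarrow> real" where
  "overlap t v = max 0 (min 1 (t - v))"

lemma overlap_bounds: "0 \<le> overlap t v" "overlap t v \<le> 1"
  by (auto simp: overlap_def)

lemma sum_overlap: "0 \<le> t \<Longrightarrow> t \<le> Q \<Longrightarrow> (\<Sum>v<Q. overlap t v) = t"
proof (induction Q)
  case (Suc Q)
  show ?case
  proof (cases "t \<le> Q")
    case False
    then have "(\<Sum>v<Q. overlap t v) = (\<Sum>v<Q. 1)" by (intro sum.cong) (auto simp: overlap_def)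
    then show ?thesis using False Suc by (simp add: overlap_def)
  qed (use Suc in \<open>simp add: overlap_def\<close>)
qed simp

lemma sum_overlap_diff:
  assumes "0 \<le> s" "s \<le> Q" "0 \<le> t" "t \<le> Q"
  shows "(\<Sum>v<Q. \<bar>overlap s v - overlap t v\<bar>) = \<bar>s - t\<bar>"
proof -
  have "(\<Sum>v<Q. \<bar>overlap s v - overlap t v\<bar>) = \<bar>\<Sum>v<Q. overlap s v - overlap t v\<bar>"
  proof (cases "s \<le> t")
    case True
    then have "overlap s v \<le> overlap t v" for v by (auto simp: overlap_def)
    then show ?thesis by (subst (1 2) abs_of_nonpos) (auto intro: sum_nonpos simp: sum_negf[symmetric])
  next
    case False
    then have "overlap t v \<le> overlap s v" for v by (auto simp: overlap_def)
    then show ?thesis by (subst (1 2) abs_of_nonneg) (auto intro: sum_nonneg)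
  qed
  then show ?thesis using assms by (simp add: sum_subtractf sum_overlap)
qed

lemma sum_of_bool_less: "0 \<le> t \<Longrightarrow> (\<Sum>v<(Q::nat). of_bool (real v < t) :: real) \<le> t + 1"
proof (induction Q)
  case (Suc Q)
  show ?case
  proof (cases "real Q < t")
    case True
    have "(\<Sum>v<Q. of_bool (real v < t) :: real) \<le> (\<Sum>v<Q. 1)" by (intro sum_mono) auto
    then show ?thesis using True by simp
  qed (use Suc in simp)
qed simp

lemma sum_threshold_diff:
  assumes "0 \<le> s" "s \<le> Q" "0 \<le> t" "t \<le> Q"
  shows "(\<Sum>v<Q. \<bar>overlap s v - of_bool (real v < t)\<bar>) \<le> \<bar>s - t\<bar> + 1"
proof -
  have "(\<Sum>v<Q. \<bar>overlap s v - of_bool (real v < t)\<bar>) \<le>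
    (\<Sum>v<Q. \<bar>overlap s v - overlap t v\<bar> + (of_bool (real v < t) - overlap t v))"
    by (intro sum_mono) (auto simp: overlap_def)
  also have "\<dots> \<le> \<bar>s - t\<bar> + 1"
    using sum_of_bool_less[OF assms(3), of Q] sum_overlap[OF assms(3,4)] sum_overlap_diff[OF assms]
    by (simp add: sum.distrib sum_subtractf)
  finally show ?thesis .
qed

lemma le_Meet: "finite A \<Longrightarrow> (\<And>a. a \<in> A \<Longrightarrow> c \<le> p a) \<Longrightarrow> c \<le> Meet p A"
  by (induction A rule: finite_induct) auto

lemma Meet_le: "finite A \<Longrightarrow> a \<in> A \<Longrightarrow> Meet p A \<le> p a"
  by (simp add: Meet.remove)

context ordered_boolean_prob
begin

text \<open>\<open>couple Q L \<phi>\<close> is the expectation of \<open>\<phi>\<close> for a coupling of a random atom of the algebra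
  generated by \<open>set L\<close> with independent variables \<open>z b\<close>, uniform on \<open>{..<Q}\<close>. The entries of \<open>L\<close>
  are decided from last to first, so that \<open>b\<close> contains the atom if and only if a uniform point
  of \<open>[z b / Q, (z b + 1) / Q]\<close> lies below the conditional probability of \<open>b\<close>.\<close>

definition couple1 :: "nat \<Rightarrow> 'b set \<Rightarrow> 'b \<Rightarrow> ('b set \<Rightarrow> ('b \<Rightarrow> nat) \<Rightarrow> real) \<Rightarrow> 'b set \<Rightarrow> ('b \<Rightarrow> nat) \<Rightarrow> real" where
  "couple1 Q D b \<phi> A z = (\<Sum>v<Q. overlap (Q * cond b D A) v * \<phi> (insert b A) (z(b := v))
     + (1 - overlap (Q * cond b D A) v) * \<phi> A (z(b := v))) / Q"

fun couple :: "nat \<Rightarrow> 'b list \<Rightarrow> ('b set \<Rightarrow> ('b \<Rightarrow> nat) \<Rightarrow> real) \<Rightarrow> ('b \<Rightarrow> nat) \<Rightarrow> real" where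
  "couple Q [] \<phi> = \<phi> {}"
| "couple Q (b # L) \<phi> = couple Q L (couple1 Q (set L) b \<phi>)"

fun simulate :: "nat \<Rightarrow> 'b list \<Rightarrow> ('b \<Rightarrow> nat) \<Rightarrow> 'b set" where
  "simulate Q [] z = {}"
| "simulate Q (b # L) z = (let A = simulate Q L z in
     if real (z b) < Q * cond b (set L) A then insert b A else A)"

lemma couple_mono:
  "(\<And>A z. A \<subseteq> set L \<Longrightarrow> \<phi> A z \<le> \<psi> A z) \<Longrightarrow> couple Q L \<phi> z \<le> couple Q L \<psi> z"
proof (induction L arbitrary: \<phi> \<psi>)
  case (Cons b L)
  have "couple1 Q (set L) b \<phi> A z \<le> couple1 Q (set L) b \<psi> A z" if "A \<subseteq> set L" for A z
    unfolding couple1_def using that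
    by (intro divide_right_mono sum_mono add_mono mult_left_mono Cons.prems) (auto simp: overlap_bounds)
  then show ?case by (simp add: Cons.IH)
qed simp

lemma couple1_add: "couple1 Q D b (\<lambda>A z. \<phi> A z + \<psi> A z) = (\<lambda>A z. couple1 Q D b \<phi> A z + couple1 Q D b \<psi> A z)"
  by (simp add: couple1_def fun_eq_iff algebra_simps sum.distrib sum_subtractf add_divide_distrib diff_divide_distrib)

lemma couple_add: "couple Q L (\<lambda>A z. \<phi> A z + \<psi> A z) z = couple Q L \<phi> z + couple Q L \<psi> z"
  by (induction L arbitrary: \<phi> \<psi>) (simp_all add: couple1_add)

lemma couple1_zero: "couple1 Q D b (\<lambda>A z. 0) = (\<lambda>A z. 0)"
  by (simp add: couple1_def fun_eq_iff)

lemma couple_zero: "couple Q L (\<lambda>A z. 0) z = 0"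
  by (induction L) (simp_all add: couple1_zero)

lemma couple_sum: "finite I \<Longrightarrow> couple Q L (\<lambda>A z. \<Sum>i\<in>I. \<phi> i A z) z = (\<Sum>i\<in>I. couple Q L (\<phi> i) z)"
  by (induction I rule: finite_induct) (simp_all add: couple_zero couple_add)

lemma couple_marginal_uniform: "distinct L \<Longrightarrow> couple Q L (\<lambda>A. f) z = avg Q (set L) f z"
proof (induction L arbitrary: f)
  case (Cons b L)
  have "couple1 Q (set L) b (\<lambda>A. f) = (\<lambda>A. avg1 Q b f)"
    by (simp add: couple1_def avg1_def fun_eq_iff algebra_simps)
  then show ?case using Cons by (simp add: avg_insert2)
qed simp

lemma couple_marginal_atoms:
  assumes "Q > 0"
  shows "distinct L \<Longrightarrow> couple Q L (\<lambda>A z. g A) z = (\<Sum>A\<in>Pow (set L). \<nu> (atom_of (set L) A) * g A)"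
proof (induction L arbitrary: g)
  case Nil
  then show ?case by (simp add: total)
next
  case (Cons b L)
  define \<theta> where "\<theta> A = cond b (set L) A" for A
  have \<theta>: "(\<Sum>v<Q. overlap (Q * \<theta> A) v) = Q * \<theta> A" for A
    using cond_bounds[of b "set L" A] by (intro sum_overlap) (auto simp: \<theta>_def mult_left_le)
  have "couple1 Q (set L) b (\<lambda>A z. g A) = (\<lambda>A z. \<theta> A * g (insert b A) + (1 - \<theta> A) * g A)"
    using assms by (simp add: couple1_def fun_eq_iff \<theta>_def[symmetric] sum.distrib sum_distrib_right[symmetric] sum_subtractf \<theta>)
      (simp add: field_simps)
  then have "couple Q (b # L) (\<lambda>A z. g A) z =
    (\<Sum>A\<in>Pow (set L). \<nu> (atom_of (set L) A) * (\<theta> A * g (insert b A) + (1 - \<theta> A) * g A))"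
    using Cons by simp
  also have "\<dots> = (\<Sum>A\<in>Pow (set L). \<nu> (atom_of (set (b # L)) (insert b A)) * g (insert b A) + \<nu> (atom_of (set (b # L)) A) * g A)"
  proof (rule sum.cong[OF refl])
    fix A assume A: "A \<in> Pow (set L)"
    have b: "b \<notin> A" "b \<notin> set L" using A Cons.prems by auto
    have 1: "atom_of (set L) (insert b A) = atom_of (set L) A" by (rule atom_of_cong) (use b in auto)
    have 2: "\<nu> (atom_of (set L) A) * \<theta> A = \<nu> (inf b (atom_of (set L) A))" unfolding \<theta>_def by (rule cond_mult)
    have "\<nu> (atom_of (set L) A) * (\<theta> A * g (insert b A) + (1 - \<theta> A) * g A) =
       (\<nu> (atom_of (set L) A) * \<theta> A) * g (insert b A) + (\<nu> (atom_of (set L) A) - \<nu> (atom_of (set L) A) * \<theta> A) * g A"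
      by (simp add: algebra_simps)
    also have "\<dots> = \<nu> (inf b (atom_of (set L) A)) * g (insert b A) + \<nu> (inf (- b) (atom_of (set L) A)) * g A"
      unfolding 2 using split[of "atom_of (set L) A" b] by simp
    finally show "\<nu> (atom_of (set L) A) * (\<theta> A * g (insert b A) + (1 - \<theta> A) * g A) =
       \<nu> (atom_of (set (b # L)) (insert b A)) * g (insert b A) + \<nu> (atom_of (set (b # L)) A) * g A"
      using b by (simp add: atom_of_insert 1)
  qed
  also have "\<dots> = (\<Sum>A\<in>Pow (set (b # L)). \<nu> (atom_of (set (b # L)) A) * g A)"
    using Cons.prems by (simp add: sum_Pow_insert)
  finally show ?case .
qed

lemma simulate_cong: "(\<And>x. x \<in> set L \<Longrightarrow> z x = w x) \<Longrightarrow> simulate Q L z = simulate Q L w"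
  by (induction L) (auto simp: Let_def)

lemma couple_mismatch:
  assumes Q: "Q > 0"
  shows "descending L \<Longrightarrow> network d (filter (\<lambda>x. x \<in> S) L) \<Longrightarrow>
    couple Q L (\<lambda>A z. of_bool (A \<inter> S \<noteq> simulate Q (filter (\<lambda>x. x \<in> S) L) z)) z \<le> d + length (filter (\<lambda>x. x \<in> S) L) / Q"
proof (induction L arbitrary: d)
  case (Cons b L)
  let ?M = "filter (\<lambda>x. x \<in> S) L"
  define \<mu> :: "'b set \<Rightarrow> ('b \<Rightarrow> nat) \<Rightarrow> real" where "\<mu> A z = of_bool (A \<inter> S \<noteq> simulate Q ?M z)" for A z
  have b: "b \<notin> set L" "distinct L" using Cons.prems(1) irrefl_lt descending_distinct by auto
  have sim: "simulate Q ?M (z(b := v)) = simulate Q ?M z" for z v by (rule simulate_cong) (use b in auto)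
  show ?case
  proof (cases "b \<in> S")
    case False
    have "couple1 Q (set L) b (\<lambda>A z. of_bool (A \<inter> S \<noteq> simulate Q ?M z)) = \<mu>"
      using Q False by (simp add: couple1_def fun_eq_iff \<mu>_def sim algebra_simps)
    then show ?thesis using Cons False by (simp add: \<mu>_def[abs_def])
  next
    case True
    define g where "g A = \<bar>cond b (set L) A - cond b (set ?M) (A \<inter> set ?M)\<bar> + 1 / Q" for A
    obtain e where e: "e \<ge> 0" "network (d - e) ?M" 
      "\<And>D. finite D \<Longrightarrow> (\<forall>x\<in>D. lt x b) \<Longrightarrow> set ?M \<subseteq> D \<Longrightarrow> energy b D \<le> energy b (set ?M) + e\<^sup>2"
      using Cons.prems(2) True by auto
    have step: "couple1 Q (set L) b (\<lambda>A z. of_bool (A \<inter> S \<noteq> simulate Q (b # ?M) z)) A z \<le> \<mu> A z + g A"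
      if A: "A \<subseteq> set L" for A z
    proof (cases "A \<inter> S = simulate Q ?M z")
      case agree: True
      define t where "t = Q * cond b (set ?M) (A \<inter> set ?M)"
      define s where "s = Q * cond b (set L) A"
      have "A \<inter> set ?M = simulate Q ?M z" using agree A by auto
      then have sim': "simulate Q (b # ?M) (z(b := v)) = (if real v < t then insert b (A \<inter> S) else A \<inter> S)" for v
        by (simp add: sim agree t_def Let_def)
      have bA: "b \<notin> A" using A b by auto
      have "couple1 Q (set L) b (\<lambda>A z. of_bool (A \<inter> S \<noteq> simulate Q (b # ?M) z)) A z
        = (\<Sum>v<Q. \<bar>overlap s v - of_bool (real v < t)\<bar>) / Q"
        unfolding couple1_def sim' s_def[symmetric] using True bA overlap_bounds[of s]
        by (intro arg_cong2[where f="(/)"] sum.cong refl) (auto simp: abs_if not_less intro: antisym)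
      also have "\<dots> \<le> (\<bar>s - t\<bar> + 1) / Q"
        using cond_bounds by (intro divide_right_mono sum_threshold_diff) (auto simp: s_def t_def mult_left_le)
      also have "\<dots> = g A" using Q by (simp add: g_def s_def t_def right_diff_distrib[symmetric] abs_mult add_divide_distrib)
      finally show ?thesis by (simp add: \<mu>_def)
    next
      case False
      have "couple1 Q (set L) b (\<lambda>A z. of_bool (A \<inter> S \<noteq> simulate Q (b # ?M) z)) A z \<le> (\<Sum>v<Q. 1) / Q"
        unfolding couple1_def using overlap_bounds[of "Q * cond b (set L) A"]
        by (intro divide_right_mono sum_mono) auto
      also have "\<dots> = \<mu> A z" using False Q by (simp add: \<mu>_def)
      finally show ?thesis by (simp add: g_def add_increasing2)
    qed
    have "couple Q (b # L) (\<lambda>A z. of_bool (A \<inter> S \<noteq> simulate Q (b # ?M) z)) z \<le> couple Q L (\<lambda>A z. \<mu> A z + g A) z"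
      unfolding couple.simps by (rule couple_mono) (rule step)
    also have "\<dots> = couple Q L \<mu> z + (\<Sum>A\<in>Pow (set L). \<nu> (atom_of (set L) A) * g A)"
      using couple_add[of Q L \<mu> "\<lambda>A z. g A" z] couple_marginal_atoms[OF Q b(2), of g z] by simp
    also have "(\<Sum>A\<in>Pow (set L). \<nu> (atom_of (set L) A) * g A) =
      (\<Sum>A\<in>Pow (set L). \<nu> (atom_of (set L) A) * \<bar>cond b (set L) A - cond b (set ?M) (A \<inter> set ?M)\<bar>) + 1 / Q"
      using sum_atoms_1[of "set L"]
      by (simp add: g_def distrib_left sum.distrib) (simp add: sum_divide_distrib[symmetric])
    also have "(\<Sum>A\<in>Pow (set L). \<nu> (atom_of (set L) A) * \<bar>cond b (set L) A - cond b (set ?M) (A \<inter> set ?M)\<bar>) \<le> e"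
      by (rule cond_L1_le) (use e Cons.prems in auto)
    also have "couple Q L \<mu> z \<le> (d - e) + length ?M / Q"
      unfolding \<mu>_def[abs_def] by (rule Cons.IH) (use Cons.prems e in auto)
    finally show ?thesis using True by (simp add: add_divide_distrib)
  qed
qed simp

lemma measure_Meet_approx:
  fixes d :: real
  assumes "finite I" "Q > 0" and net: "\<And>a. a \<in> I \<Longrightarrow> network d (es a)" and ne: "\<And>a. a \<in> I \<Longrightarrow> es a \<noteq> []"
    and len: "\<And>a. a \<in> I \<Longrightarrow> length (es a) \<le> d * Q"
  shows "\<bar>\<nu> (Meet (\<lambda>a. hd (es a)) I) -
     avg Q (\<Union>a\<in>I. set (es a)) (\<lambda>z. \<Prod>a\<in>I. of_bool (hd (es a) \<in> simulate Q (es a) z)) z\<bar> \<le> card I * (2 * d)"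
proof -
  define T where "T = (\<Union>a\<in>I. set (es a))"
  have "finite T" using assms(1) by (auto simp: T_def)
  then obtain L where L: "descending L" "set L = T" using finite_descending by blast
  have dist: "distinct L" using L(1) descending_distinct by blast
  have filter: "filter (\<lambda>x. x \<in> set (es a)) L = es a" if "a \<in> I" for a
    by (rule descending_unique) (use L network_descending[OF net[OF that]] that in \<open>auto simp: T_def sorted_wrt_filter\<close>)
  have hd: "hd (es a) \<in> T" if "a \<in> I" for a using hd_in_set[OF ne[OF that]] that by (auto simp: T_def)
  define \<phi> :: "'b set \<Rightarrow> ('b \<Rightarrow> nat) \<Rightarrow> real" where "\<phi> A z = (\<Prod>a\<in>I. of_bool (hd (es a) \<in> A))" for A z
  define \<psi> :: "('b \<Rightarrow> nat) \<Rightarrow> real" where "\<psi> z = (\<Prod>a\<in>I. of_bool (hd (es a) \<in> simulate Q (es a) z))" for z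
  define mis :: "'b set \<Rightarrow> ('b \<Rightarrow> nat) \<Rightarrow> real" where
    "mis A z = (\<Sum>a\<in>I. of_bool (A \<inter> set (es a) \<noteq> simulate Q (es a) z))" for A z
  have "couple Q L (\<lambda>A z. of_bool (A \<inter> set (es a) \<noteq> simulate Q (es a) z)) z \<le> 2 * d" if "a \<in> I" for a
  proof -
    have "couple Q L (\<lambda>A z. of_bool (A \<inter> set (es a) \<noteq> simulate Q (es a) z)) z \<le> d + length (es a) / Q"
      using couple_mismatch[OF assms(2) L(1), of d "set (es a)" z] filter[OF that] net[OF that] by simp
    also have "length (es a) / Q \<le> d" using len[OF that] assms(2) by (simp add: divide_le_eq)
    finally show ?thesis by simp
  qed
  then have mis: "couple Q L mis z \<le> card I * (2 * d)"
    unfolding mis_def[abs_def] couple_sum[OF assms(1)] by (intro sum_bounded_above)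
  have diff: "\<phi> A z \<le> \<psi> z + mis A z \<and> \<psi> z \<le> \<phi> A z + mis A z" for A z
  proof (cases "\<forall>a\<in>I. A \<inter> set (es a) = simulate Q (es a) z")
    case True
    then have "hd (es a) \<in> simulate Q (es a) z \<longleftrightarrow> hd (es a) \<in> A" if "a \<in> I" for a using ne that by force
    then have "\<phi> A z = \<psi> z" by (simp add: \<phi>_def \<psi>_def)
    moreover have "mis A z \<ge> 0" by (auto simp: mis_def intro: sum_nonneg)
    ultimately show ?thesis by simp
  next
    case False
    then obtain a where a: "a \<in> I" "A \<inter> set (es a) \<noteq> simulate Q (es a) z" by blast
    have "mis A z \<ge> 1"
      unfolding mis_def using a assms(1) member_le_sum[of a I "\<lambda>a. of_bool (A \<inter> set (es a) \<noteq> simulate Q (es a) z) :: real"] by simp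
    moreover have "0 \<le> \<phi> A z" "\<phi> A z \<le> 1" "0 \<le> \<psi> z" "\<psi> z \<le> 1"
      by (auto simp: \<phi>_def \<psi>_def intro: prod_nonneg prod_le_1)
    ultimately show ?thesis by linarith
  qed
  have "couple Q L \<phi> z \<le> couple Q L (\<lambda>A. \<psi>) z + couple Q L mis z"
    using couple_mono[of L \<phi> "\<lambda>A z. \<psi> z + mis A z"] diff by (simp add: couple_add)
  moreover have "couple Q L (\<lambda>A. \<psi>) z \<le> couple Q L \<phi> z + couple Q L mis z"
    using couple_mono[of L "\<lambda>A. \<psi>" "\<lambda>A z. \<phi> A z + mis A z"] diff by (simp add: couple_add)
  moreover have "couple Q L (\<lambda>A. \<psi>) z = avg Q T \<psi> z" using couple_marginal_uniform[OF dist] L(2) by simp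
  moreover have "couple Q L \<phi> z = \<nu> (Meet (\<lambda>a. hd (es a)) I)"
  proof -
    let ?m = "Meet (\<lambda>a. hd (es a)) I"
    have "couple Q L \<phi> z = (\<Sum>A\<in>Pow T. \<nu> (atom_of T A) * (\<Prod>a\<in>I. of_bool (hd (es a) \<in> A)))"
      unfolding \<phi>_def[abs_def] using couple_marginal_atoms[OF assms(2) dist] L(2) by simp
    also have "\<dots> = (\<Sum>A\<in>Pow T. \<nu> (inf ?m (atom_of T A)))"
    proof (rule sum.cong[OF refl])
      fix A
      have le: "atom_of T A \<le> (if x \<in> A then x else - x)" if "x \<in> T" for x
        unfolding atom_of_def using Meet_le[OF \<open>finite T\<close> that, of "\<lambda>x. if x \<in> A then x else - x"] .
      show "\<nu> (atom_of T A) * (\<Prod>a\<in>I. of_bool (hd (es a) \<in> A)) = \<nu> (inf ?m (atom_of T A))"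
      proof (cases "\<forall>a\<in>I. hd (es a) \<in> A")
        case True
        then have "atom_of T A \<le> hd (es a)" if "a \<in> I" for a using le[OF hd[OF that]] that by auto
        then have "atom_of T A \<le> ?m" by (rule le_Meet[OF assms(1)])
        then show ?thesis using True by (simp add: inf_absorb2)
      next
        case False
        then obtain a where a: "a \<in> I" "hd (es a) \<notin> A" by blast
        have "inf ?m (atom_of T A) \<le> inf (hd (es a)) (- hd (es a))"
          using Meet_le[OF assms(1) a(1), of "\<lambda>a. hd (es a)"] le[OF hd[OF a(1)]] a(2) by (intro inf_mono) auto
        then have "inf ?m (atom_of T A) = bot" by (simp add: bot_unique)
        moreover have "\<nu> bot = 0" using additive[of bot bot] by simp
        moreover have "(\<Prod>a\<in>I. of_bool (hd (es a) \<in> A)) = (0 :: real)" using a assms(1) by auto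
        ultimately show ?thesis by simp
      qed
    qed
    also have "\<dots> = \<nu> ?m" by (rule sum_atoms_top[OF \<open>finite T\<close>])
    finally show ?thesis .
  qed
  ultimately show ?thesis using mis by (simp add: T_def \<psi>_def[abs_def] abs_le_iff)
qed

end

section \<open>Measure algebras are linked\<close>

lemma avg_cong_bounded:
  assumes "finite T" "\<And>z. (\<And>x. z x < Q) \<Longrightarrow> f z = g z" "\<And>x. z x < Q"
  shows "avg Q T f z = avg Q T g z"
  using assms(1,3)
proof (induction T arbitrary: z rule: finite_induct)
  case (insert x T)
  have "avg Q T f (z(x := v)) = avg Q T g (z(x := v))" if "v < Q" for v
    by (rule insert.IH) (use insert.prems that in auto)
  then show ?case by (simp add: avg_insert[OF insert.hyps] avg1_def)
qed (use assms(2) in simp)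

lemma nths_cong: "(\<And>l. l < length a \<Longrightarrow> l \<in> A \<longleftrightarrow> l \<in> B) \<Longrightarrow> nths a A = nths a B"
  unfolding nths_def by (rule arg_cong[where f = "map fst"], rule filter_cong) (auto dest: set_zip_rightD)

lemma in_listset_iff: "a \<in> listset As \<longleftrightarrow> length a = length As \<and> (\<forall>i<length As. a ! i \<in> As ! i)"
proof (induction As arbitrary: a)
  case (Cons A As)
  show ?case by (cases a) (auto simp: set_Cons_def Cons nth_Cons less_Suc_eq_0_disj split: nat.split)
qed auto

lemma compatible_tuples_nth:
  assumes "a \<in> increasing_tuples n" "b \<in> increasing_tuples n" "compatible_tuples a b"
    and "p < n" "q < n" "a ! p = b ! q"
  shows "p = q"
proof -
  have a: "length a = n" "sorted_wrt (<) a" and b: "length b = n" "sorted_wrt (<) b"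
    using assms by (auto simp: increasing_tuples_def)
  obtain f where f: "bij_betw f (set a) (set b)" "strict_mono_on (set a) f" "\<forall>x\<in>set a \<inter> set b. f x = x"
    using assms(3) by (auto simp: compatible_tuples_def)
  have "map f a = b"
  proof (rule sorted_wrt_set_unique)
    show "sorted_wrt (<) (map f a)"
      unfolding sorted_wrt_map using a(2) f(2) by (rule_tac sorted_wrt_mono_rel[of a "(<)"]) (auto simp: strict_mono_on_def)
    show "set (map f a) = set b" using f(1) by (simp add: bij_betw_def)
  qed (rule b(2))
  then have "b ! p = f (a ! p)" using a assms by auto
  also have "\<dots> = b ! q" using f(3) a b assms(4-6) by (metis IntI nth_mem)
  finally show ?thesis using b assms(4,5) by (metis nth_eq_iff_index_eq strict_sorted_iff)
qed

lemma (in normal_uniform_ideal) linked_subset: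
  fixes \<nu> :: "'b::boolean_algebra \<Rightarrow> real" and M :: nat
  assumes "ordered_boolean_prob \<nu> lt" and M: "M \<ge> 1"
    and inc: "X \<subseteq> increasing_tuples n" and X: "pos n X" and p: "\<And>a. a \<in> X \<Longrightarrow> \<nu> (p a) > 0"
  shows "\<exists>Y\<subseteq>X. pos n Y \<and> (\<forall>F. finite F \<longrightarrow> F \<subseteq> Y \<longrightarrow> card F \<le> M \<longrightarrow>
    (\<forall>a\<in>F. \<forall>b\<in>F. compatible_tuples a b) \<longrightarrow> \<nu> (Meet p F) > 0)"
proof -
  interpret ordered_boolean_prob \<nu> lt by fact
  have "\<exists>j. 1 / Suc j \<le> \<nu> (p a)" if "a \<in> X" for a
    using p[OF that] by (metis inverse_eq_divide less_imp_le reals_Archimedean)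
  then obtain j where j: "\<And>a. a \<in> X \<Longrightarrow> 1 / Suc (j a) \<le> \<nu> (p a)" by metis
  obtain j0 where j0: "pos n {a\<in>X. j a = j0}" using pos_countable_constant[OF X, of j] by blast
  define \<epsilon> where "\<epsilon> = 1 / Suc j0"
  define X1 where "X1 = {a\<in>X. j a = j0}"
  have \<epsilon>: "\<epsilon> > 0" "\<And>a. a \<in> X1 \<Longrightarrow> \<nu> (p a) \<ge> \<epsilon>" using j by (auto simp: \<epsilon>_def X1_def)
  have "\<epsilon> \<le> 1" by (simp add: \<epsilon>_def)
  define c0 where "c0 = (\<epsilon> / 2) ^ (M ^ n)"
  have c0: "c0 > 0" using \<epsilon> by (simp add: c0_def)
  define d where "d = min (\<epsilon> / 4) (c0 / (4 * M))"
  have d: "d > 0" "2 * d \<le> \<epsilon> / 2" "M * (2 * d) \<le> c0 / 2"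
  proof -
    show "d > 0" using \<epsilon> c0 M by (simp add: d_def)
    show "2 * d \<le> \<epsilon> / 2" by (simp add: d_def min_def)
    have "d \<le> c0 / (4 * M)" by (simp add: d_def)
    then show "M * (2 * d) \<le> c0 / 2" using M by (simp add: field_simps)
  qed
  have "\<forall>a. \<exists>L. network d (p a # L)" using network_exists[OF d(1)] by blast
  then obtain L where L: "\<And>a. network d (p a # L a)" by metis
  define es where "es a = p a # L a" for a
  have es: "network d (es a)" "hd (es a) = p a" "es a \<noteq> []" for a using L by (auto simp: es_def)
  have "\<exists>Q::nat. Q > 0 \<and> length (es a) \<le> d * Q" for a
  proof -
    obtain Q :: nat where "length (es a) / d < Q" using reals_Archimedean2 by blast
    then have "length (es a) < d * Q" using d(1) by (simp add: divide_less_eq mult.commute)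
    moreover from this have "Q > 0" by (cases Q) auto
    ultimately show ?thesis by (intro exI[of _ Q]) auto
  qed
  then obtain Qf :: "'k list \<Rightarrow> nat" where Qf: "\<And>a. Qf a > 0" "\<And>a. length (es a) \<le> d * Qf a" by metis
  define Hf where "Hf a = {map z (es a) | z. (\<forall>x. z x < Qf a) \<and> p a \<in> simulate (Qf a) (es a) z}" for a
  have "finite (Hf a)" for a
  proof (rule finite_subset)
    show "Hf a \<subseteq> {xs. set xs \<subseteq> {..<Qf a} \<and> length xs = length (es a)}" by (auto simp: Hf_def)
  qed (rule finite_lists_length_eq, simp)
  then have "\<forall>a. \<exists>l. set l = Hf a" using finite_list by blast
  then obtain Hl where Hl: "\<And>a. set (Hl a) = Hf a" by metis
  obtain t where t: "pos n {a\<in>X1. (length (es a), Qf a, Hl a) = t}"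
    using pos_countable_constant[OF j0, of "\<lambda>a. (length (es a), Qf a, Hl a)"] unfolding X1_def by blast
  obtain k Q hl where t_eq: "t = (k, Q, hl)" by (cases t) auto
  define H where "H = set hl"
  define X2 where "X2 = {a\<in>X1. (length (es a), Qf a, Hl a) = t}"
  have X2: "pos n X2" "X2 \<subseteq> X" using t by (auto simp: X2_def X1_def)
  have len: "length (es a) = k" and Qa: "Qf a = Q" and Ha: "Hf a = H" and \<epsilon>a: "\<nu> (p a) \<ge> \<epsilon>" if "a \<in> X2" for a
    using that Hl[of a] \<epsilon>(2) by (auto simp: X2_def t_eq H_def)
  have "\<exists>a. a \<in> X2" using pos_nonempty X2 by blast
  then obtain a0 where a0: "a0 \<in> X2" by blast
  have Q: "Q > 0" "k \<le> d * Q" using Qf[of a0] Qa[OF a0] len[OF a0] by auto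
  have event: "p a \<in> simulate Q (es a) z \<longleftrightarrow> map z (es a) \<in> H" if "a \<in> X2" "\<And>x. z x < Q" for a z
  proof
    assume "map z (es a) \<in> H"
    then have "map z (es a) \<in> Hf a" using Ha[OF that(1)] by simp
    then obtain w where w: "map z (es a) = map w (es a)" "p a \<in> simulate Q (es a) w"
      unfolding Hf_def Qa[OF \<open>a \<in> X2\<close>] by blast
    have "simulate Q (es a) z = simulate Q (es a) w" by (rule simulate_cong) (use w(1) in auto)
    then show "p a \<in> simulate Q (es a) z" using w by simp
  qed (use Ha[OF that(1)] Qa[OF that(1)] that(2) in \<open>auto simp: Hf_def\<close>)
  have approx: "\<bar>\<nu> (Meet p F) - avg Q (\<Union>a\<in>F. set (es a)) (\<lambda>z. \<Prod>a\<in>F. of_bool (map z (es a) \<in> H)) (\<lambda>_. 0)\<bar>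
      \<le> card F * (2 * d)" if F: "finite F" "F \<subseteq> X2" for F
  proof -
    have "\<bar>\<nu> (Meet (\<lambda>a. hd (es a)) F) - avg Q (\<Union>a\<in>F. set (es a))
        (\<lambda>z. \<Prod>a\<in>F. of_bool (hd (es a) \<in> simulate Q (es a) z)) (\<lambda>_. 0)\<bar> \<le> card F * (2 * d)"
      by (rule measure_Meet_approx) (use F Q es len in auto)
    moreover have "avg Q (\<Union>a\<in>F. set (es a)) (\<lambda>z. \<Prod>a\<in>F. of_bool (hd (es a) \<in> simulate Q (es a) z)) (\<lambda>_. 0)
       = avg Q (\<Union>a\<in>F. set (es a)) (\<lambda>z. \<Prod>a\<in>F. of_bool (map z (es a) \<in> H)) (\<lambda>_. 0)"
      using F Q by (intro avg_cong_bounded prod.cong refl) (auto simp: es event)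
    ultimately show ?thesis by (simp add: es(2))
  qed
  have dist: "distinct (es a)" for a using descending_distinct network_descending es(1) by blast
  have base: "avg Q ({..<k} \<times> {[]}) (\<lambda>z. of_bool (map (\<lambda>i. z (i, [] :: 'k list)) [0..<k] \<in> H)) z \<ge> \<epsilon> / 2" for z
  proof -
    define g :: "(nat \<times> 'k list \<Rightarrow> nat) \<Rightarrow> real" where "g z = of_bool (map (\<lambda>i. z (i, [])) [0..<k] \<in> H)" for z
    define \<sigma> :: "nat \<times> 'k list \<Rightarrow> 'b" where "\<sigma> = (\<lambda>(i, s). es a0 ! i)"
    let ?K = "{..<k} \<times> {[] :: 'k list}"
    have dep: "depends_on g ?K"
      unfolding depends_on_def g_def
      by (intro allI impI arg_cong[where f = of_bool] arg_cong[where f = "\<lambda>l. l \<in> H"] map_cong refl) auto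
    have map: "map (\<lambda>i. (w \<circ> \<sigma>) (i, [])) [0..<k] = map w (es a0)" for w
      using len[OF a0] by (auto simp: \<sigma>_def intro: nth_equalityI)
    have img: "\<sigma> ` ?K = set (es a0)"
      using len[OF a0] by (force simp: \<sigma>_def set_conv_nth image_iff)
    have inj: "inj_on \<sigma> ?K" using dist[of a0] len[OF a0] by (auto simp: inj_on_def \<sigma>_def nth_eq_iff_index_eq)
    have "avg Q (set (es a0)) (\<lambda>w. of_bool (map w (es a0) \<in> H)) (\<lambda>_. 0) = avg Q ?K g ((\<lambda>_. 0) \<circ> \<sigma>)"
    proof -
      have "avg Q (\<sigma> ` ?K) (\<lambda>w. g (w \<circ> \<sigma>)) (\<lambda>_. 0) = avg Q ?K g ((\<lambda>_. 0) \<circ> \<sigma>)"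
        by (rule avg_rename[OF _ inj order_refl dep]) simp
      moreover have "(\<lambda>w. g (w \<circ> \<sigma>)) = (\<lambda>w. of_bool (map w (es a0) \<in> H))"
        unfolding g_def map ..
      ultimately show ?thesis unfolding img by (simp only:)
    qed
    also have "\<dots> = avg Q ?K g z"
      by (rule depends_onD[OF depends_on_avg[OF _ dep]]) auto
    finally show ?thesis using approx[of "{a0}"] a0 \<epsilon>a[OF a0] d(2) unfolding g_def[abs_def] by simp
  qed
  obtain Y I c where Y: "Y \<subseteq> X2" "pos n Y" and c: "\<And>i a. i < k \<Longrightarrow> a \<in> Y \<Longrightarrow> es a ! i = c i (nths a (I i))"
    and canon: "\<And>i j a b. i < k \<Longrightarrow> j < k \<Longrightarrow> a \<in> Y \<Longrightarrow> b \<in> Y \<Longrightarrow> es a ! i = es b ! j \<Longrightarrow> nths a (I i) = nths b (I j)"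
    by (rule canonical_form[OF X2(1) order_trans[OF X2(2) inc], where k = k and e = "\<lambda>i a. es a ! i"])
      (rule that; assumption)
  have tup: "a \<in> increasing_tuples n" "length a = n" if "a \<in> Y" for a
    using that Y X2 inc by (auto simp: increasing_tuples_def)
  have "\<nu> (Meet p F) > 0" if F: "finite F" "F \<subseteq> Y" "card F \<le> M" and comp: "\<forall>a\<in>F. \<forall>b\<in>F. compatible_tuples a b" for F
  proof -
    have eq: "i = j" if ij: "i < k" "j < k" and ab: "a \<in> F" "b \<in> F" and s: "nths a (I i) = nths b (I j)"
      and e: "es a ! i = es b ! j" for i j a b
    proof -
      have Yab: "a \<in> Y" "b \<in> Y" using ab F by auto
      have pos: "p = q" if "p < n" "q < n" "a ! p = b ! q" for p q
        using compatible_tuples_nth that comp ab tup Yab by blast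
      have sub: "set (nths a (I i)) = {a ! l | l. l < n \<and> l \<in> I i}" "set (nths b (I j)) = {b ! l | l. l < n \<and> l \<in> I j}"
        using tup Yab by (simp_all add: set_nths)
      have "nths a (I j) = nths a (I i)"
      proof (rule nths_cong)
        fix l assume "l < length a"
        then have l: "l < n" using tup Yab by simp
        show "l \<in> I j \<longleftrightarrow> l \<in> I i"
        proof
          assume "l \<in> I i"
          then have "a ! l \<in> set (nths b (I j))" using l unfolding s[symmetric] sub by blast
          then obtain l' where "l' < n" "l' \<in> I j" "a ! l = b ! l'" unfolding sub by blast
          then show "l \<in> I j" using pos[OF l] by simp
        next
          assume "l \<in> I j"
          then have "b ! l \<in> set (nths a (I i))" using l unfolding s sub by blast
          then obtain l' where "l' < n" "l' \<in> I i" "b ! l = a ! l'" unfolding sub by blast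
          then show "l \<in> I i" using pos[OF _ l, of l'] by simp
        qed
      qed
      then have "es a ! j = es a ! i" using c[of j a] c[of j b] s e ij Yab by simp
      then show ?thesis using dist[of a] ij len Yab Y by (metis nth_eq_iff_index_eq subsetD)
    qed
    define \<iota> where "\<iota> = (\<lambda>(i, s). c i s)"
    define K where "K = grid_index k I F"
    have inj: "inj_on \<iota> K"
    proof (rule inj_onI)
      fix x y assume "x \<in> K" "y \<in> K" and xy: "\<iota> x = \<iota> y"
      then obtain i a j b where x: "x = (i, nths a (I i))" "i < k" "a \<in> F" and y: "y = (j, nths b (I j))" "j < k" "b \<in> F"
        by (auto simp: K_def grid_index_def)
      have e: "es a ! i = es b ! j" 
        using x(1) y(1) xy c[OF x(2) subsetD[OF F(2) x(3)]] c[OF y(2) subsetD[OF F(2) y(3)]] by (simp add: \<iota>_def)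
      have s: "nths a (I i) = nths b (I j)" using canon[OF x(2) y(2) _ _ e] x y F by blast
      show "x = y" using eq[OF x(2) y(2) x(3) y(3) s e] s x y by simp
    qed
    have img: "\<iota> ` K = (\<Union>a\<in>F. set (es a))"
    proof -
      have "set (es a) = {c i (nths a (I i)) | i. i < k}" if "a \<in> F" for a
        using c[of _ a] len[of a] that F Y by (force simp: set_conv_nth)
      moreover have "\<iota> ` K = (\<Union>a\<in>F. {c i (nths a (I i)) | i. i < k})"
        by (force simp: K_def grid_index_def \<iota>_def image_iff)
      ultimately show ?thesis by auto
    qed
    have finK: "finite K" unfolding K_def by (rule finite_grid_index[OF F(1)])
    have map: "map z (es a) = map (\<lambda>i. (z \<circ> \<iota>) (i, nths a (I i))) [0..<k]" if "a \<in> F" for a and z :: "'b \<Rightarrow> nat"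
    proof -
      have "a \<in> Y" "length (es a) = k" using that F(2) Y(1) len by auto
      then show ?thesis using c[of _ a] by (intro nth_equalityI) (auto simp: \<iota>_def)
    qed
    have "(\<lambda>z. \<Prod>a\<in>F. of_bool (map z (es a) \<in> H)) = (\<lambda>z. grid_event k H I F (z \<circ> \<iota>))"
      unfolding grid_event_def by (intro ext prod.cong refl) (simp only: map)
    then have "avg Q (\<Union>a\<in>F. set (es a)) (\<lambda>z. \<Prod>a\<in>F. of_bool (map z (es a) \<in> H)) (\<lambda>_. 0) =
      avg Q (\<iota> ` K) (\<lambda>z. grid_event k H I F (z \<circ> \<iota>)) (\<lambda>_. 0)"
      unfolding img by (rule arg_cong)
    also have "\<dots> = avg Q K (grid_event k H I F) ((\<lambda>_. 0) \<circ> \<iota>)"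
      by (rule avg_rename[OF finK inj order_refl]) (simp add: K_def depends_on_grid_event)
    finally have avg_eq: "avg Q (\<Union>a\<in>F. set (es a)) (\<lambda>z. \<Prod>a\<in>F. of_bool (map z (es a) \<in> H)) (\<lambda>_. 0) =
      avg Q K (grid_event k H I F) ((\<lambda>_. 0) \<circ> \<iota>)" .
    define As where "As = map (\<lambda>l. (\<lambda>a. a ! l) ` F) [0..<n]"
    define G where "G = listset As"
    have finA: "\<And>A. A \<in> set As \<Longrightarrow> finite A" using F(1) by (auto simp: As_def)
    have finG: "finite G" unfolding G_def by (rule finite_listset) (rule finA)
    have FG: "F \<subseteq> G" using F tup by (auto simp: G_def in_listset_iff As_def)
    have cardG: "card G \<le> M ^ n"
    proof -
      have "card G = (\<Prod>l<n. card ((\<lambda>a. a ! l) ` F))"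
        by (simp add: G_def card_listset As_def comp_def prod.list_conv_set_nth atLeast0LessThan)
      also have "\<dots> \<le> (\<Prod>l<n. M)" using F by (intro prod_mono) (auto intro: order_trans[OF card_image_le])
      finally show ?thesis by simp
    qed
    have F_eq: "avg Q K (grid_event k H I F) ((\<lambda>_. 0) \<circ> \<iota>) = avg Q (grid_index k I G) (grid_event k H I F) ((\<lambda>_. 0) \<circ> \<iota>)"
      unfolding K_def
      by (rule arg_cong2[OF avg_superset[symmetric] refl, of _ _ _ _ "\<lambda>f. f"])
         (use finG FG Q finite_grid_index depends_on_grid_event in \<open>auto simp: grid_index_def\<close>)
    have F_ge: "avg Q (grid_index k I G) (grid_event k H I F) ((\<lambda>_. 0) \<circ> \<iota>)
      \<ge> avg Q (grid_index k I G) (grid_event k H I G) ((\<lambda>_. 0) \<circ> \<iota>)"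
    proof (rule avg_mono[OF finite_grid_index[OF finG]])
      fix z
      have "grid_event k H I G z = grid_event k H I F z * grid_event k H I (G - F) z"
        unfolding grid_event_def using prod.subset_diff[OF FG finG] by (simp add: mult.commute)
      also have "\<dots> \<le> grid_event k H I F z"
        by (rule mult_left_le[OF grid_event_le_1 grid_event_nonneg])
      finally show "grid_event k H I G z \<le> grid_event k H I F z" .
    qed
    have "c0 \<le> (\<epsilon> / 2) ^ card G"
      unfolding c0_def using \<epsilon> \<open>\<epsilon> \<le> 1\<close> cardG by (intro power_decreasing) auto
    also have "\<dots> \<le> avg Q (grid_index k I G) (grid_event k H I G) ((\<lambda>_. 0) \<circ> \<iota>)"
      unfolding G_def by (rule grid_density[OF Q(1) _ base finA]) (use \<epsilon> in simp)
    finally have "avg Q K (grid_event k H I F) ((\<lambda>_. 0) \<circ> \<iota>) \<ge> c0" using F_eq F_ge by linarith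
    moreover have "card F * (2 * d) \<le> M * (2 * d)" using F(3) d(1) by (intro mult_right_mono) auto
    moreover have "\<bar>\<nu> (Meet p F) - avg Q K (grid_event k H I F) ((\<lambda>_. 0) \<circ> \<iota>)\<bar> \<le> card F * (2 * d)"
      using approx[OF F(1) order_trans[OF F(2) Y(1)]] unfolding avg_eq .
    ultimately show ?thesis using d(3) c0 by linarith
  qed
  moreover have "Y \<subseteq> X" using Y X2 by blast
  ultimately show ?thesis using Y(2) by blast
qed

lemma (in normal_uniform_ideal) fubini_power_iff:
  "X \<subseteq> increasing_tuples n \<Longrightarrow> X \<in> fubini_power J n \<longleftrightarrow> \<not> pos n X"
proof (induction n arbitrary: X rule: induct_nat_012)
  case 0
  then show ?case by (auto simp: increasing_tuples_def)
next
  case 1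
  then show ?case by simp
next
  case (ge2 n)
  have "{b \<in> increasing_tuples (Suc n). \<alpha> # b \<in> X} = {b. \<alpha> # b \<in> X}" for \<alpha>
    using ge2.prems by (auto simp: increasing_tuples_def)
  moreover have "{b. \<alpha> # b \<in> X} \<in> fubini_power J (Suc n) \<longleftrightarrow> \<not> pos (Suc n) {b. \<alpha> # b \<in> X}" for \<alpha>
    by (rule ge2.IH(2)) (use ge2.prems in \<open>auto simp: increasing_tuples_def\<close>)
  ultimately show ?case using ge2.prems by (simp add: dual_filter_def Collect_neg_eq[symmetric] del: pos.simps(2)) simp
qed

lemma (in normal_uniform_ideal) fubini_positive_iff: "X \<in> fubini_positive J n \<longleftrightarrow> X \<subseteq> increasing_tuples n \<and> pos n X"
  using fubini_power_iff by (auto simp: fubini_positive_def)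

lemma normal_uniform_idealI:
  fixes J :: "'k::wellorder set set"
  assumes "is_cardinal_type TYPE('k)" "proper_ideal J" "uniform_ideal J" "normal_ideal J" "saturated_ideal \<gamma> J"
  shows "normal_uniform_ideal J"
proof
  show un: "A \<union> B \<in> J" if "A \<in> J" "B \<in> J" for A B using that assms(2) unfolding proper_ideal_def by blast
  show "{} \<in> J" "UNIV \<notin> J" using assms(2) unfolding proper_ideal_def by auto
  show "B \<in> J" if "A \<in> J" "B \<subseteq> A" for A B using that assms(2) unfolding proper_ideal_def by blast
  show "normal_ideal J" by fact
  fix \<alpha> :: 'k
  have "\<exists>i j :: 'k. i < j" using assms(5) \<open>UNIV \<notin> J\<close> unfolding saturated_ideal_def by (metis (no_types))
  then obtain i j :: 'k where "i < j" by blast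
  then have "\<nexists>f. f ` {\<alpha>} = (UNIV :: 'k set)" by (metis UNIV_I image_insert image_empty less_irrefl singletonD)
  then have "|{\<alpha>}| <o |UNIV :: 'k set|" by (subst card_of_ordLess2[symmetric]) auto
  moreover have "|{..<\<alpha>}| <o |UNIV :: 'k set|"
  proof -
    let ?r = "{(x, y :: 'k). x \<le> y}"
    have r: "Field ?r = UNIV" "Card_order ?r"
    proof -
      show "Field ?r = UNIV" by (auto simp: Field_def)
      then show "Card_order ?r" using assms(1) unfolding is_cardinal_type_def by simp
    qed
    have "|underS ?r \<alpha>| <o ?r" using card_of_underS[OF r(2)] r(1) by simp
    moreover have "underS ?r \<alpha> = {..<\<alpha>}" by (auto simp: underS_def)
    moreover have "?r =o |UNIV :: 'k set|" using card_of_Field_ordIso[OF r(2)] r(1) ordIso_symmetric by metis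
    ultimately show ?thesis using ordLess_ordIso_trans by metis
  qed
  ultimately have "{\<alpha>} \<union> {..<\<alpha>} \<in> J" using assms(3) un unfolding uniform_ideal_def by blast
  moreover have "{\<alpha>} \<union> {..<\<alpha>} = {..\<alpha>}" by auto
  ultimately show "{..\<alpha>} \<in> J" by simp
qed

lemma measure_algebra_boolean_prob:
  assumes "measure_algebra \<mu>" "(top :: 'b::boolean_algebra) \<noteq> bot"
  shows "boolean_prob (\<lambda>x :: 'b. \<mu> x / \<mu> top)"
proof -
  have bot: "\<mu> bot = 0" and posi: "\<And>x. x \<noteq> bot \<Longrightarrow> \<mu> x > 0"
    and add: "\<And>f s. (\<And>i j. i \<noteq> j \<Longrightarrow> inf (f i) (f j) = bot) \<Longrightarrow> isLub UNIV (range f) s \<Longrightarrow> (\<lambda>i::nat. \<mu> (f i)) sums \<mu> s"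
    using assms(1) unfolding measure_algebra_def by blast+
  have nonneg: "\<mu> x \<ge> 0" for x using bot posi by (metis less_imp_le order_refl)
  have "\<mu> (sup x y) = \<mu> x + \<mu> y" if "inf x y = bot" for x y
  proof -
    define f where "f i = (if i = 0 then x else if i = 1 then y else bot)" for i :: nat
    have "range f = {x, y, bot}"
    proof
      show "{x, y, bot} \<subseteq> range f" using rangeI[of f 0] rangeI[of f 1] rangeI[of f 2] by (simp add: f_def)
    qed (auto simp: f_def)
    then have "isLub UNIV (range f) (sup x y)"
      by (auto simp: isLub_def leastP_def isUb_def setle_def setge_def)
    moreover have "inf (f i) (f j) = bot" if "i \<noteq> j" for i j
      using that \<open>inf x y = bot\<close> by (auto simp: f_def inf_commute)
    ultimately have "(\<lambda>i. \<mu> (f i)) sums \<mu> (sup x y)" by (intro add) auto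
    moreover have "(\<lambda>i. \<mu> (f i)) sums (\<Sum>i\<in>{0, 1}. \<mu> (f i))" by (rule sums_finite) (auto simp: f_def bot)
    ultimately show ?thesis by (auto simp: f_def dest: sums_unique2)
  qed
  then show ?thesis using nonneg posi[OF assms(2)] by unfold_locales (auto simp: add_divide_distrib)
qed

theorem theorem4p3:
  fixes J :: "'k::wellorder set set"
    and \<gamma> :: 'k
    and m n :: nat
    and \<mu> :: "'b::boolean_algebra \<Rightarrow> real"
  assumes "is_cardinal_type TYPE('k)"
    and "proper_ideal J"
    and "uniform_ideal J"
    and "normal_ideal J"
    and "saturated_ideal \<gamma> J"
    and "measure_algebra \<mu>"
  shows "fubini_linked J n m {x :: 'b. x \<noteq> bot}"
  unfolding fubini_linked_def
proof (intro ballI allI impI)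
  fix X and p :: "'k list \<Rightarrow> 'b" assume X: "X \<in> fubini_positive J n" and p: "\<forall>a\<in>X. p a \<in> {x. x \<noteq> bot}"
  interpret normal_uniform_ideal J using assms(1-5) by (rule normal_uniform_idealI)
  have X': "X \<subseteq> increasing_tuples n" "pos n X" using X by (auto simp: fubini_positive_iff)
  obtain a where "a \<in> X" using X'(2) pos_nonempty by blast
  then have top: "(top :: 'b) \<noteq> bot" using p by (metis (mono_tags) bot_unique mem_Collect_eq top_greatest)
  define \<nu> where "\<nu> x = \<mu> x / \<mu> top" for x
  have \<nu>_pos: "\<nu> x > 0 \<longleftrightarrow> x \<noteq> bot" for x
    using assms(6) top unfolding measure_algebra_def \<nu>_def by (metis divide_pos_pos div_0 less_irrefl)
  have "\<exists>r :: 'b rel. well_order r" by (rule well_order_on)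
  then obtain r :: "'b rel" where r: "well_order r" by (elim exE)
  have prob: "ordered_boolean_prob \<nu> (\<lambda>x y. (x, y) \<in> r - Id)"
  proof (intro ordered_boolean_prob.intro ordered_boolean_prob_axioms.intro)
    show "boolean_prob \<nu>" unfolding \<nu>_def[abs_def] by (rule measure_algebra_boolean_prob[OF assms(6) top])
    have "{(x, y). (x, y) \<in> r - Id} = r - Id" by auto
    then show "wfp (\<lambda>x y. (x, y) \<in> r - Id)" using r by (simp only: well_order_on_def wfp_def)
    have lin: "trans r" "antisym r" "total_on UNIV r"
      using r by (auto simp: well_order_on_def linear_order_on_def partial_order_on_def preorder_on_def)
    show "(x, z) \<in> r - Id" if "(x, y) \<in> r - Id" "(y, z) \<in> r - Id" for x y z
      using that lin unfolding trans_def antisym_def by blast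
    show "(x, y) \<in> r - Id \<or> (y, x) \<in> r - Id" if "x \<noteq> y" for x y
      using that lin(3) by (auto simp: total_on_def)
  qed
  have "\<exists>Y\<subseteq>X. pos n Y \<and> (\<forall>F. finite F \<longrightarrow> F \<subseteq> Y \<longrightarrow> card F \<le> max 1 m \<longrightarrow>
        (\<forall>a\<in>F. \<forall>b\<in>F. compatible_tuples a b) \<longrightarrow> \<nu> (Meet p F) > 0)"
    by (rule linked_subset[OF prob max.cobounded1 X']) (use p \<nu>_pos in simp)
  then obtain Y where "Y \<subseteq> X \<and> pos n Y \<and>
      (\<forall>F. finite F \<longrightarrow> F \<subseteq> Y \<longrightarrow> card F \<le> max 1 m \<longrightarrow>
        (\<forall>a\<in>F. \<forall>b\<in>F. compatible_tuples a b) \<longrightarrow> \<nu> (Meet p F) > 0)"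
    by (elim exE)
  then have Y: "Y \<subseteq> X" "pos n Y" and linked: "\<And>F. finite F \<Longrightarrow> F \<subseteq> Y \<Longrightarrow> card F \<le> max 1 m \<Longrightarrow>
      (\<forall>a\<in>F. \<forall>b\<in>F. compatible_tuples a b) \<Longrightarrow> \<nu> (Meet p F) > 0"
    by simp_all
  have "\<exists>q\<in>{x. x \<noteq> bot}. \<forall>a\<in>set as. q \<le> p a"
    if as: "length as \<le> m" "set as \<subseteq> Y" "\<forall>a\<in>set as. \<forall>b\<in>set as. compatible_tuples a b" for as
  proof (intro bexI ballI)
    have "card (set as) \<le> max 1 m" using as(1) card_length[of as] by simp
    then show "Meet p (set as) \<in> {x. x \<noteq> bot}" using linked[of "set as"] as \<nu>_pos by simp
    show "Meet p (set as) \<le> p a" if "a \<in> set as" for a using that by (intro Meet_le) auto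
  qed
  moreover have "Y \<in> fubini_positive J n" using Y X' by (auto simp: fubini_positive_iff)
  ultimately show "\<exists>Y\<in>fubini_positive J n. Y \<subseteq> X \<and> (\<forall>as. length as \<le> m \<longrightarrow> set as \<subseteq> Y \<longrightarrow>
      (\<forall>a\<in>set as. \<forall>b\<in>set as. compatible_tuples a b) \<longrightarrow> (\<exists>q\<in>{x. x \<noteq> bot}. \<forall>a\<in>set as. q \<le> p a))"
    using Y(1) by blast
qed

end
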